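(* Let $\delta,\rho\in(0,1)$. For each $n>1$, let $m=\delta n$, $k=\rho m$ and $d<m$. Let $\mu,\nu\in\mathbb{D}(\mathbb{R})$ and $(A,\hat y)\sim \mathrm{GM}(n,m,k,d,\mu,\nu)$, with associated $x$, $\eta$, $y=Ax$ and $\hat y=y+\eta$. For $i\in[m]$ and $i_1\neq i_2$ in $[m]$ put $$p_z(\omega)=\mathbb{P}\left(y_i=0\mid \hat y_i=\omega\right),\qquad p_e(\omega)=\mathbb{P}\left(y_{i_1}=y_{i_2}\mid \hat y_{i_1}-\hat y_{i_2}=\omega\right).$$ Then, as $n\to\infty$, $$p_z(\omega)\to \frac{\nu(\omega)}{\sum_{q\ge 0}\frac{(d\rho)^q}{q!}(\nu*\mu_q)(\omega)},\qquad p_e(\omega)\to \frac{\tilde\nu(\omega)}{\sum_{q\ge 0}\frac{(2d\rho)^q}{q!}(\tilde\nu*\bar\mu_q)(\omega)},$$ where $\mu_q$, $\bar\mu_q$, $\tilde\nu$ are the probability measures constructed from $\mu$ and $\nu$ as described in the context.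
   Context: Notation: $\mathbb{D}(\mathbb{R})$ is the set of probability distributions supported on $\mathbb{R}$; $[n]=\{1,\dots,n\}$; $[n]^{(k)}$ is the set of subsets of $[n]$ of cardinality $k$; $\mathrm{supp}$ denotes the set of indices of nonzero entries of a vector. Generating model $\mathrm{GM}(n,m,k,d,\mu,\nu)$: let $n,m,k,d\in\mathbb{N}$ with $k<m<n$ and $d\ll m$, and let $\mu,\nu\in\mathbb{D}(\mathbb{R})$. The problem $(A,\hat y)$ is drawn from this model if $A\in\{0,1\}^{m\times n}$ and $\hat y\in\mathbb{R}^m$ are such that: (1) each column of $A$ has a support drawn uniformly at random from $[m]^{(d)}$ (with entries equal to $1$ on the support); (2) $\mathrm{supp}(x)$, for the signal $x\in\mathbb{R}^n$, is drawn uniformly at random from $[n]^{(k)}$; (3) the values $x_j$, $j\in\mathrm{supp}(x)$, are drawn i.i.d. from $\mu$; (4) the noise entries $\eta_i$, $i\in[m]$, are drawn i.i.d. from $\nu$; (5) $\eta_i$ is independent of $x_j$ for all $i\in[m]$, $j\in\mathrm{supp}(x)$; (6) $y=Ax$ and $\hat y=y+\eta$. Measures: for $\mu\in\mathbb{D}(\mathbb{R})$ and Borel sets $E\subset\mathbb{R}$, with $-E=\{-x:x\in E\}$: the $q$-fold convolutions are $\mu_0=\delta_0$ (point mass at $0$), $\mu_1=\mu$, $\mu_{q+1}=\mu_q*\mu$; the negative measure is $\mu^-(E)=\mu(-E)$; the symmetrized measure is $\bar\mu(E)=\frac{1}{2}(\mu(E)+\mu(-E))$, and $\bar\mu_q$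 is the $q$-fold convolution of $\bar\mu$ (with $\bar\mu_0=\delta_0$); the measure associated with the difference of two random variables is $\tilde\mu=\mu*\mu^-$, so that $\tilde\nu=\nu*\nu^-$. For a distribution $\lambda$, $\lambda(\omega)$ denotes its value at the point $\omega$ (its density at $\omega$ when $\lambda$ has one), and the conditional probabilities $p_z(\omega)$, $p_e(\omega)$ are those given by Bayes' rule with the same reading of $\mathbb{P}(\,\cdot=\omega)$.
   Formalization: Added, as the claim fails otherwise (e.g. μ uniform on {-1,1}): μ_q({0})=0 for all q≥1 for p_z, and μ without atoms for p_e. Values λ(ω) are all point masses, or all densities, the latter for a.e. ω and where continuous; m and k are rounded to integers. *)

theory Defs
  imports "HOL-Probability.Probability" "HOL-Library.Ramsey"
begin

section \<open>Measures derived from a distribution\<close>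

primrec conv_power :: "real measure \<Rightarrow> nat \<Rightarrow> real measure" where
  "conv_power \<mu> 0 = return borel 0"
| "conv_power \<mu> (Suc q) = convolution (conv_power \<mu> q) \<mu>"

definition negative :: "real measure \<Rightarrow> real measure" where
  "negative \<mu> = distr \<mu> borel uminus"

definition symmetrized :: "real measure \<Rightarrow> real measure" where
  "symmetrized \<mu> =
     measure_of UNIV (sets borel) (\<lambda>E. (emeasure \<mu> E + emeasure \<mu> (uminus ` E)) / 2)"

lemma emeasure_symmetrized:
  assumes "sets \<mu> = sets borel" and E: "E \<in> sets borel"
  shows "emeasure (symmetrized \<mu>) E = (emeasure \<mu> E + emeasure \<mu> (uminus ` E)) / 2"
proof -
  have im: "uminus ` B = uminus -` B" for B :: "real set"
    by force
  have meas: "uminus ` B \<in> sets borel" if "B \<in> sets borel" for B :: "real set"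
    unfolding im using measurable_sets[OF borel_measurable_uminus[OF measurable_ident] that]
    by (simp add: id_def)
  have "sigma_sets UNIV (sets borel) = sets (borel :: real measure)"
    using sets.sigma_sets_eq[of "borel :: real measure"] by simp
  then have sets: "sets (symmetrized \<mu>) = sets borel"
    by (simp add: symmetrized_def sets_measure_of_conv)
  show ?thesis
  proof (rule emeasure_measure_of[OF symmetrized_def])
    show "countably_additive (sets (symmetrized \<mu>))
      (\<lambda>E. (emeasure \<mu> E + emeasure \<mu> (uminus ` E)) / 2)"
    proof (rule countably_additiveI)
      fix B :: "nat \<Rightarrow> real set"
      assume "range B \<subseteq> sets (symmetrized \<mu>)" and d: "disjoint_family B"
      then have B: "range B \<subseteq> sets \<mu>"
        using assms sets by simp
      then have B': "range (\<lambda>n. uminus ` B n) \<subseteq> sets \<mu>"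
        using meas assms by (simp add: image_subset_iff)
      have d': "disjoint_family (\<lambda>n. uminus ` B n)"
        using d unfolding im disjoint_family_on_def by blast
      have "(\<Sum>n. (emeasure \<mu> (B n) + emeasure \<mu> (uminus ` B n)) / 2) =
          (\<Sum>n. emeasure \<mu> (B n) + emeasure \<mu> (uminus ` B n)) / 2"
        by simp
      also have "(\<Sum>n. emeasure \<mu> (B n) + emeasure \<mu> (uminus ` B n)) =
          (\<Sum>n. emeasure \<mu> (B n)) + (\<Sum>n. emeasure \<mu> (uminus ` B n))"
        by (simp add: suminf_add[symmetric])
      also have "(\<Sum>n. emeasure \<mu> (B n)) = emeasure \<mu> (\<Union>n. B n)"
        by (rule suminf_emeasure[OF B d])
      also have "(\<Sum>n. emeasure \<mu> (uminus ` B n)) = emeasure \<mu> (\<Union>n. uminus ` B n)"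
        by (rule suminf_emeasure[OF B' d'])
      finally show "(\<Sum>n. (emeasure \<mu> (B n) + emeasure \<mu> (uminus ` B n)) / 2) =
          (emeasure \<mu> (\<Union>n. B n) + emeasure \<mu> (uminus ` (\<Union>n. B n))) / 2"
        by (simp only: image_UN)
    qed
    show "positive (sets (symmetrized \<mu>))
      (\<lambda>E. (emeasure \<mu> E + emeasure \<mu> (uminus ` E)) / 2)"
      by (simp add: positive_def)
  qed (simp_all add: sets E)
qed

definition difference :: "real measure \<Rightarrow> real measure" where
  "difference \<mu> = convolution \<mu> (negative \<mu>)"


section \<open>The value of a distribution at a point\<close>

definition is_cont_density :: "real measure \<Rightarrow> real \<Rightarrow> (real \<Rightarrow> real) \<Rightarrow> bool" where
  "is_cont_density \<kappa> \<omega> f \<longleftrightarrow>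
     f \<in> borel_measurable borel \<and> (\<forall>t. 0 \<le> f t) \<and>
     \<kappa> = density lborel (\<lambda>t. ennreal (f t)) \<and> isCont f \<omega>"

definition has_cont_density_at :: "real measure \<Rightarrow> real \<Rightarrow> bool" where
  "has_cont_density_at \<kappa> \<omega> \<longleftrightarrow> (\<exists>f. is_cont_density \<kappa> \<omega> f)"

text \<open>
  A density is determined only up to Lebesgue null sets. Where some version is continuous,
  its value there does not depend on the version (lemma \<open>density_at_eq\<close> below) and is used;
  elsewhere the value is that of the Radon-Nikodym derivative of the library, which is
  meaningful for almost every \<open>\<omega>\<close> only.
\<close>

definition density_at :: "real measure \<Rightarrow> real \<Rightarrow> ennreal" where
  "density_at \<kappa> \<omega> =
     (if has_cont_density_at \<kappa> \<omega> then ennreal ((SOME f. is_cont_density \<kappa> \<omega> f) \<omega>)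
      else RN_deriv lborel \<kappa> \<omega>)"

definition mass_at :: "real measure \<Rightarrow> real \<Rightarrow> ennreal" where
  "mass_at \<kappa> \<omega> = emeasure \<kappa> {\<omega>}"

lemma cont_density_unique:
  assumes f: "is_cont_density \<kappa> \<omega> f" and g: "is_cont_density \<kappa> \<omega> g"
  shows "f \<omega> = g \<omega>"
proof (rule ccontr)
  assume "f \<omega> \<noteq> g \<omega>"
  have m[measurable]: "f \<in> borel_measurable borel" "g \<in> borel_measurable borel"
    using f g by (auto simp: is_cont_density_def)
  have "density lborel (\<lambda>t. ennreal (f t)) = density lborel (\<lambda>t. ennreal (g t))"
    using f g by (simp add: is_cont_density_def)
  then have "AE t in lborel. ennreal (f t) = ennreal (g t)"
    by (subst (asm) sigma_finite_measure.density_unique_iff[OF lborel.sigma_finite_measure_axioms])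
      auto
  then have ae: "AE t in lborel. f t = g t"
    by eventually_elim (use f g in \<open>auto simp: is_cont_density_def\<close>)
  have "isCont (\<lambda>t. f t - g t) \<omega>"
    using f g by (auto simp: is_cont_density_def)
  moreover have "f \<omega> - g \<omega> \<noteq> 0" using \<open>f \<omega> \<noteq> g \<omega>\<close> by simp
  ultimately have "\<forall>\<^sub>F t in nhds \<omega>. f t - g t \<noteq> 0"
    unfolding eventually_nhds_conv_at isCont_def by (intro conjI) (erule tendsto_imp_eventually_ne, assumption+)
  then obtain S where S: "open S" "\<omega> \<in> S" "\<And>t. t \<in> S \<Longrightarrow> f t \<noteq> g t"
    unfolding eventually_nhds by auto
  have "AE t in lborel. t \<notin> S"
    using ae by eventually_elim (use S in auto)
  then have "emeasure lborel S = 0"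
    using S by (subst (asm) AE_iff_measurable[OF _ refl]) auto
  moreover obtain e where e: "e > 0" "ball \<omega> e \<subseteq> S"
    using S by (meson open_contains_ball)
  moreover have "emeasure lborel (ball \<omega> e) \<le> emeasure lborel S"
    using e S by (intro emeasure_mono) auto
  moreover have "emeasure lborel (ball \<omega> e) = ennreal (2 * e)"
    using e by (simp add: ball_eq_greaterThanLessThan)
  ultimately show False by auto
qed

lemma density_at_eq:
  assumes "is_cont_density \<kappa> \<omega> f"
  shows "density_at \<kappa> \<omega> = ennreal (f \<omega>)"
proof -
  have "is_cont_density \<kappa> \<omega> (SOME f. is_cont_density \<kappa> \<omega> f)"
    by (rule someI[where P = "is_cont_density \<kappa> \<omega>", OF assms])
  from cont_density_unique[OF this assms] show ?thesis
    using assms unfolding density_at_def has_cont_density_at_def by auto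
qed


section \<open>The generating model\<close>

definition supp :: "nat \<Rightarrow> (nat \<Rightarrow> real) \<Rightarrow> nat set" where
  "supp N v = {l \<in> {1..N}. v l \<noteq> 0}"

abbreviation vectors :: "nat \<Rightarrow> (nat \<Rightarrow> real) measure" where
  "vectors N \<equiv> PiM {1..N} (\<lambda>_. borel)"

datatype component = Column nat | Signal | Noise

text \<open>
  \<open>A w i j\<close>, \<open>x w j\<close> and \<open>\<eta> w i\<close> are the entries, with indices starting at 1, of the random
  matrix, signal and noise. The last conjunct makes the columns of the matrix, the signal and
  the noise mutually independent. Since the values are drawn on the support, their law is
  prescribed conditionally on the support of the signal.
\<close>

definition generating_model ::
  "'w measure \<Rightarrow> nat \<Rightarrow> nat \<Rightarrow> nat \<Rightarrow> nat \<Rightarrow> real measure \<Rightarrow> real measure \<Rightarrow>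
   ('w \<Rightarrow> nat \<Rightarrow> nat \<Rightarrow> real) \<Rightarrow> ('w \<Rightarrow> nat \<Rightarrow> real) \<Rightarrow> ('w \<Rightarrow> nat \<Rightarrow> real) \<Rightarrow> bool" where
  "generating_model M n m k d \<mu> \<nu> A x \<eta> \<longleftrightarrow>
     prob_space M \<and> k < m \<and> m < n \<and> d < m \<and>
     (\<forall>w \<in> space M. \<forall>i \<in> {1..m}. \<forall>j \<in> {1..n}. A w i j \<in> {0, 1}) \<and>
     (\<forall>j \<in> {1..n}. distr M (count_space UNIV) (\<lambda>w. supp m (\<lambda>i. A w i j)) =
        measure_pmf (pmf_of_set (nsets {1..m} d))) \<and>
     distr M (count_space UNIV) (\<lambda>w. supp n (x w)) =
        measure_pmf (pmf_of_set (nsets {1..n} k)) \<and>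
     (\<forall>T \<in> nsets {1..n} k.
        distr (uniform_measure M {w \<in> space M. supp n (x w) = T}) (PiM T (\<lambda>_. borel))
          (\<lambda>w. restrict (x w) T) = PiM T (\<lambda>_. \<mu>)) \<and>
     distr M (vectors m) (\<lambda>w. restrict (\<eta> w) {1..m}) = PiM {1..m} (\<lambda>_. \<nu>) \<and>
     prob_space.indep_vars M
       (\<lambda>c. case c of Column j \<Rightarrow> vectors m | Signal \<Rightarrow> vectors n | Noise \<Rightarrow> vectors m)
       (\<lambda>c w. case c of
            Column j \<Rightarrow> restrict (\<lambda>i. A w i j) {1..m}
          | Signal \<Rightarrow> restrict (x w) {1..n}
          | Noise \<Rightarrow> restrict (\<eta> w) {1..m})
       (Column ` {1..n} \<union> {Signal, Noise})"

definition clean :: "nat \<Rightarrow> ('w \<Rightarrow> nat \<Rightarrow> nat \<Rightarrow> real) \<Rightarrow> ('w \<Rightarrow> nat \<Rightarrow> real) \<Rightarrow> 'w \<Rightarrow> nat \<Rightarrow> real" where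
  "clean n A x w i = (\<Sum>j = 1..n. A w i j * x w j)"

definition noisy ::
  "nat \<Rightarrow> ('w \<Rightarrow> nat \<Rightarrow> nat \<Rightarrow> real) \<Rightarrow> ('w \<Rightarrow> nat \<Rightarrow> real) \<Rightarrow> ('w \<Rightarrow> nat \<Rightarrow> real) \<Rightarrow>
   'w \<Rightarrow> nat \<Rightarrow> real" where
  "noisy n A x \<eta> w i = clean n A x w i + \<eta> w i"


section \<open>Conditional probabilities\<close>

text \<open>
  Bayes' rule for the probability of \<open>E\<close> given \<open>X = \<omega>\<close>, where \<open>val \<kappa> \<omega>\<close> is the value of the
  law \<open>\<kappa>\<close> at \<open>\<omega>\<close>, either \<open>density_at\<close> or \<open>mass_at\<close>. Division is that of \<open>ennreal\<close>: \<open>0 / 0 = 0\<close>, and a finite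
  number divided by \<open>\<infinity>\<close> is \<open>0\<close>.
\<close>

definition bayes ::
  "(real measure \<Rightarrow> real \<Rightarrow> ennreal) \<Rightarrow> 'w measure \<Rightarrow> 'w set \<Rightarrow> ('w \<Rightarrow> real) \<Rightarrow> real \<Rightarrow> ennreal" where
  "bayes val M E X \<omega> =
     val (distr (uniform_measure M E) borel X) \<omega> * emeasure M E / val (distr M borel X) \<omega>"

definition p_zero ::
  "(real measure \<Rightarrow> real \<Rightarrow> ennreal) \<Rightarrow> 'w measure \<Rightarrow> nat \<Rightarrow> ('w \<Rightarrow> nat \<Rightarrow> nat \<Rightarrow> real) \<Rightarrow>
   ('w \<Rightarrow> nat \<Rightarrow> real) \<Rightarrow> ('w \<Rightarrow> nat \<Rightarrow> real) \<Rightarrow> nat \<Rightarrow> real \<Rightarrow> ennreal" where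
  "p_zero val M n A x \<eta> i \<omega> =
     bayes val M {w \<in> space M. clean n A x w i = 0} (\<lambda>w. noisy n A x \<eta> w i) \<omega>"

definition p_equal ::
  "(real measure \<Rightarrow> real \<Rightarrow> ennreal) \<Rightarrow> 'w measure \<Rightarrow> nat \<Rightarrow> ('w \<Rightarrow> nat \<Rightarrow> nat \<Rightarrow> real) \<Rightarrow>
   ('w \<Rightarrow> nat \<Rightarrow> real) \<Rightarrow> ('w \<Rightarrow> nat \<Rightarrow> real) \<Rightarrow> nat \<Rightarrow> nat \<Rightarrow> real \<Rightarrow> ennreal" where
  "p_equal val M n A x \<eta> i1 i2 \<omega> =
     bayes val M {w \<in> space M. clean n A x w i1 = clean n A x w i2}
       (\<lambda>w. noisy n A x \<eta> w i1 - noisy n A x \<eta> w i2) \<omega>"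

definition poisson_ratio ::
  "(real measure \<Rightarrow> real \<Rightarrow> ennreal) \<Rightarrow> real \<Rightarrow> real measure \<Rightarrow> real measure \<Rightarrow> real \<Rightarrow> ennreal" where
  "poisson_ratio val c \<kappa> \<mu> \<omega> =
     val \<kappa> \<omega> / (\<Sum>q. ennreal (c ^ q / fact q) * val (convolution \<kappa> (conv_power \<mu> q)) \<omega>)"

end

theory Submission
  imports Defs
begin

text \<open>
  Why it holds. A coordinate \<open>y_i\<close>, and likewise a difference \<open>y_i1 - y_i2\<close>, is a sum
  \<open>\<Sum>j. e_j * x_j\<close> in which the coefficients \<open>e_j\<close>, one for each column of the matrix, are i.i.d.,
  independent of the signal and with values in \<open>{0, 1}\<close> or in \<open>{-1, 0, 1}\<close>. Each of the \<open>k\<close> signal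
  values thus survives with a small probability \<open>r\<close>, about \<open>d / m\<close> or \<open>2 * d / m\<close>, and a survivor has law
  \<open>\<mu>\<close>; for differences its sign is uniform, which turns \<open>\<mu>\<close> into its symmetrization.
  So the sum is distributed as the mixture of the convolution powers \<open>\<mu>_q\<close> with binomial weights in
  \<open>q\<close> (\<open>nn_integral_thinned_sum\<close>, \<open>nn_integral_signal_part\<close>). The noise is independent of
  the sum and adds one convolution with its law \<open>\<kappa>\<close>, so the observed law is the same mixture of the
  \<open>\<kappa> * \<mu>_q\<close>. By the assumption on atoms a sum with a survivor vanishes with probability zero,
  so the event that it vanishes has probability \<open>(1 - r) ^ k\<close>, and given that event the observation is
  pure noise. Bayes' rule then gives \<open>val \<kappa> \<omega> * (1 - r) ^ k / val (mixture) \<omega>\<close>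
  (\<open>bayes_signal_part_zero\<close>).

  It remains to pass to the limit. The factor \<open>(1 - r) ^ k\<close> cancels (\<open>binomial_zero_fraction\<close>), which
  leaves the weights \<open>(k choose q) * t ^ q\<close> with the odds \<open>t = r / (1 - r)\<close>; they tend to
  \<open>c ^ q / fact q\<close> because \<open>k * t\<close> tends to \<open>c\<close>. The values at \<open>\<omega>\<close> of the densities of
  \<open>\<kappa> * \<mu>_q\<close> may grow arbitrarily fast with \<open>q\<close>, so the weights must be dominated by a multiple of the
  limiting weights themselves. This is possible because \<open>k\<close> is within \<open>1\<close> of \<open>\<rho> * m\<close>: then
  \<open>k * t \<le> c * (1 + K / k)\<close> for some constant \<open>K\<close> (\<open>sparse_rate\<close>), and \<open>q \<le> k\<close> bounds the
  quotient of the weights by \<open>(1 + K / k) ^ k \<le> exp K\<close> (\<open>binomial_weight_le\<close>). If the limiting series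
  converges, dominated convergence applies; if it diverges, Fatou's lemma makes the denominators
  tend to infinity and both sides vanish in the limit (\<open>weighted_suminf_tendsto\<close>).

  The value at \<open>\<omega>\<close> commutes with mixing for point masses by definition, and for densities
  at a common point of continuity because the mixture is finite. For almost every \<open>\<omega>\<close> it needs that the
  value chosen by \<open>density_at\<close>, whose version of the density may depend on \<open>\<omega>\<close>, agrees almost
  everywhere with any one fixed version (\<open>AE_density_at_eq\<close>).
\<close>

section \<open>Convolutions of distributions\<close>

lemma real_distribution_convolution:
  assumes "real_distribution \<kappa>" "real_distribution \<mu>"
  shows "real_distribution (convolution \<kappa> \<mu>)"
proof -
  interpret \<kappa>: real_distribution \<kappa> by fact
  interpret \<mu>: real_distribution \<mu> by fact
  interpret pair_prob_space \<kappa> \<mu> ..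
  have "prob_space (convolution \<kappa> \<mu>)"
    unfolding convolution_def by (rule prob_space_distr) simp
  then show ?thesis
    by (simp add: real_distribution_def real_distribution_axioms_def)
qed

lemma real_distribution_conv_power:
  assumes "real_distribution \<mu>"
  shows "real_distribution (conv_power \<mu> q)"
proof (induction q)
  case 0
  have "prob_space (return borel (0 :: real))" by (rule prob_space_return) simp
  then show ?case by (simp add: real_distribution_def real_distribution_axioms_def)
qed (auto intro: real_distribution_convolution assms)

lemma nn_integral_convolution_distribution:
  assumes "real_distribution \<kappa>" "real_distribution \<mu>" and "f \<in> borel_measurable borel"
  shows "(\<integral>\<^sup>+y. f y \<partial>convolution \<kappa> \<mu>) = (\<integral>\<^sup>+y. \<integral>\<^sup>+z. f (y + z) \<partial>\<mu> \<partial>\<kappa>)"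
proof -
  interpret \<kappa>: real_distribution \<kappa> by fact
  interpret \<mu>: real_distribution \<mu> by fact
  show ?thesis
    by (rule nn_integral_convolution) (use assms(3) in \<open>simp_all add: \<kappa>.finite_measure_axioms \<mu>.finite_measure_axioms\<close>)
qed

lemma convolution_return_zero:
  assumes "real_distribution \<kappa>"
  shows "convolution \<kappa> (return borel 0) = \<kappa>"
proof (rule measure_eqI)
  interpret real_distribution \<kappa> by fact
  fix B assume "B \<in> sets (convolution \<kappa> (return borel 0))"
  then have B[measurable]: "B \<in> sets borel" by simp
  have "real_distribution (return borel (0 :: real))"
    using real_distribution_conv_power[OF assms, of 0] by simp
  from nn_integral_convolution_distribution[OF assms this, of "indicator B"]
  have "emeasure (convolution \<kappa> (return borel 0)) B = (\<integral>\<^sup>+y. \<integral>\<^sup>+z. indicator B (y + z) \<partial>return borel 0 \<partial>\<kappa>)"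
    by simp
  also have "\<dots> = (\<integral>\<^sup>+y. indicator B y \<partial>\<kappa>)"
    by (intro nn_integral_cong) (subst nn_integral_return, auto)
  finally show "emeasure (convolution \<kappa> (return borel 0)) B = emeasure \<kappa> B"
    by simp
qed (use assms in \<open>simp add: real_distribution_def real_distribution_axioms_def\<close>)

lemma absolutely_continuous_convolution:
  assumes \<kappa>: "real_distribution \<kappa>" and \<mu>: "real_distribution \<mu>"
    and ac: "absolutely_continuous lborel \<kappa>"
  shows "absolutely_continuous lborel (convolution \<kappa> \<mu>)"
  unfolding absolutely_continuous_def
proof
  interpret \<kappa>: real_distribution \<kappa> by fact
  interpret \<mu>: real_distribution \<mu> by fact
  fix B :: "real set" assume B: "B \<in> null_sets lborel"
  then have [measurable]: "B \<in> sets borel" by (auto simp: null_sets_def)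
  have shift: "emeasure \<kappa> ((\<lambda>z. y + z) -` B) = 0" for y
  proof -
    have meas: "(\<lambda>z. y + z) -` B \<in> sets borel"
      using measurable_sets[of "\<lambda>z. y + z" borel borel B] by simp
    have "emeasure lborel ((\<lambda>z. y + z) -` B) = emeasure (distr lborel borel (\<lambda>z. y + z)) B"
      by (simp add: emeasure_distr)
    also have "\<dots> = 0"
      using B lborel_distr_plus[of y] by (auto simp: null_sets_def)
    finally have "(\<lambda>z. y + z) -` B \<in> null_sets lborel"
      using meas by (simp add: null_sets_def)
    then show ?thesis using ac by (auto simp: absolutely_continuous_def null_sets_def)
  qed
  have "emeasure (convolution \<kappa> \<mu>) B = emeasure (convolution \<mu> \<kappa>) B"
    by (subst convolution_commutative) (simp_all add: \<kappa>.finite_measure_axioms \<mu>.finite_measure_axioms)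
  also have "\<dots> = (\<integral>\<^sup>+y. indicator B y \<partial>convolution \<mu> \<kappa>)"
    by simp
  also have "\<dots> = (\<integral>\<^sup>+y. \<integral>\<^sup>+z. indicator B (y + z) \<partial>\<kappa> \<partial>\<mu>)"
    by (rule nn_integral_convolution_distribution[OF \<mu> \<kappa>]) simp
  also have "\<dots> = (\<integral>\<^sup>+y. 0 \<partial>\<mu>)"
  proof (intro nn_integral_cong)
    fix y
    have "(\<integral>\<^sup>+z. indicator B (y + z) \<partial>\<kappa>) = (\<integral>\<^sup>+z. indicator ((\<lambda>z. y + z) -` B) z \<partial>\<kappa>)"
      by (intro nn_integral_cong) (simp add: indicator_def)
    also have "\<dots> = emeasure \<kappa> ((\<lambda>z. y + z) -` B)"
      using measurable_sets[of "\<lambda>z. y + z" borel borel B] by (intro nn_integral_indicator) simp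
    finally show "(\<integral>\<^sup>+z. indicator B (y + z) \<partial>\<kappa>) = 0" using shift by simp
  qed
  finally show "B \<in> null_sets (convolution \<kappa> \<mu>)" by (simp add: null_sets_def)
qed

lemma nn_integral_symmetrized:
  assumes "sets \<mu> = sets borel" and "f \<in> borel_measurable borel"
  shows "(\<integral>\<^sup>+y. f y \<partial>symmetrized \<mu>) = ((\<integral>\<^sup>+y. f y \<partial>\<mu>) + (\<integral>\<^sup>+y. f (- y) \<partial>\<mu>)) / 2"
proof -
  have im: "uminus ` B = uminus -` B" for B :: "real set"
    by force
  have sets_eq [measurable_cong]: "sets \<mu> = sets borel" by fact
  have "sets (symmetrized \<mu>) = sets borel"
    using sets.sigma_sets_eq[of "borel :: real measure"]
    by (simp add: symmetrized_def sets_measure_of_conv)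
  note [measurable_cong] = this
  show ?thesis
    using assms(2)
  proof (induction rule: borel_measurable_induct)
    case (cong f g)
    then have "f = g" by (auto intro: ext)
    then show ?case using cong by simp
  next
    case (set B)
    have "uminus -` B \<in> sets borel"
      using measurable_sets[OF borel_measurable_uminus[OF measurable_ident] set]
      by (simp add: id_def)
    moreover have "(\<lambda>y. indicator B (- y)) = (indicator (uminus -` B) :: real \<Rightarrow> ennreal)"
      by (auto simp: indicator_def)
    ultimately show ?case
      using set emeasure_symmetrized[OF assms(1) set] \<open>sets (symmetrized \<mu>) = sets borel\<close> sets_eq
      by (simp add: im)
  next
    case (mult u c)
    then have [measurable]: "u \<in> borel_measurable borel" by simp
    show ?case
      by (simp add: nn_integral_cmult mult.IH divide_ennreal_def distrib_left distrib_right mult.assoc)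
  next
    case (add u v)
    then have [measurable]: "u \<in> borel_measurable borel" "v \<in> borel_measurable borel" by simp_all
    show ?case
      by (simp add: nn_integral_add add.IH divide_ennreal_def distrib_left distrib_right ac_simps)
  next
    case (seq U)
    have [measurable]: "\<And>i. U i \<in> borel_measurable borel" using seq by simp
    have inc: "incseq U" "incseq (\<lambda>i y. U i (- y))"
      using \<open>incseq U\<close> by (auto simp: incseq_def le_fun_def)
    have mono: "incseq (\<lambda>i. \<integral>\<^sup>+y. U i y \<partial>\<mu>)" "incseq (\<lambda>i. \<integral>\<^sup>+y. U i (- y) \<partial>\<mu>)"
      using inc by (auto simp: incseq_def le_fun_def intro!: nn_integral_mono)
    have "(\<integral>\<^sup>+y. (SUP i. U i y) \<partial>symmetrized \<mu>) = (SUP i. \<integral>\<^sup>+y. U i y \<partial>symmetrized \<mu>)"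
      using inc by (intro nn_integral_monotone_convergence_SUP) auto
    also have "\<dots> = (SUP i. ((\<integral>\<^sup>+y. U i y \<partial>\<mu>) + (\<integral>\<^sup>+y. U i (- y) \<partial>\<mu>)) * inverse 2)"
      by (simp add: seq.IH divide_ennreal_def)
    also have "\<dots> = ((SUP i. \<integral>\<^sup>+y. U i y \<partial>\<mu>) + (SUP i. \<integral>\<^sup>+y. U i (- y) \<partial>\<mu>)) * inverse 2"
      by (simp add: SUP_mult_right_ennreal[symmetric] ennreal_SUP_add[OF mono])
    also have "(SUP i. \<integral>\<^sup>+y. U i y \<partial>\<mu>) = (\<integral>\<^sup>+y. (SUP i. U i y) \<partial>\<mu>)"
      using inc by (intro nn_integral_monotone_convergence_SUP[symmetric]) auto
    also have "(SUP i. \<integral>\<^sup>+y. U i (- y) \<partial>\<mu>) = (\<integral>\<^sup>+y. (SUP i. U i (- y)) \<partial>\<mu>)"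
      using inc by (intro nn_integral_monotone_convergence_SUP[symmetric]) auto
    finally show ?case
      by (simp add: divide_ennreal_def image_comp)
  qed
qed

lemma real_distribution_symmetrized:
  assumes "real_distribution \<mu>"
  shows "real_distribution (symmetrized \<mu>)"
proof -
  interpret real_distribution \<mu> by fact
  have sets: "sets (symmetrized \<mu>) = sets borel"
    using sets.sigma_sets_eq[of "borel :: real measure"]
    by (simp add: symmetrized_def sets_measure_of_conv)
  have "emeasure (symmetrized \<mu>) UNIV = (1 + 1) / 2"
    using emeasure_symmetrized[of \<mu> UNIV] emeasure_space_1 by (simp add: surj_def)
  also have "\<dots> = 1" by (simp add: ennreal_divide_self)
  finally have "prob_space (symmetrized \<mu>)"
    using sets_eq_imp_space_eq[OF sets] by (intro prob_spaceI) simp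
  then show ?thesis
    using sets by (simp add: real_distribution_def real_distribution_axioms_def)
qed

text \<open>
  A single convolution with an atomless law already removes all atoms. For differences the absence
  of all atoms of \<open>\<mu>\<close> is what rules out cancellation, since equal values may now enter with opposite signs.
\<close>

lemma conv_power_symmetrized_no_atom:
  assumes \<mu>: "real_distribution \<mu>" and atoms: "\<forall>a. measure \<mu> {a} = 0" and "1 \<le> q"
  shows "emeasure (conv_power (symmetrized \<mu>) q) {0} = 0"
proof (cases q)
  case (Suc q')
  interpret \<mu>: real_distribution \<mu> by fact
  interpret S: real_distribution "symmetrized \<mu>"
    using \<mu> by (rule real_distribution_symmetrized)
  have atom: "emeasure (symmetrized \<mu>) {a} = 0" for a
    using atoms by (subst emeasure_symmetrized) (simp_all add: \<mu>.emeasure_eq_measure)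
  have "emeasure (conv_power (symmetrized \<mu>) q) {0} =
      (\<integral>\<^sup>+y. indicator {0} y \<partial>convolution (conv_power (symmetrized \<mu>) q') (symmetrized \<mu>))"
    using Suc by simp
  also have "\<dots> = (\<integral>\<^sup>+y. \<integral>\<^sup>+z. indicator {0} (y + z) \<partial>symmetrized \<mu> \<partial>conv_power (symmetrized \<mu>) q')"
    by (intro nn_integral_convolution_distribution real_distribution_conv_power S.real_distribution_axioms) simp
  also have "\<dots> = (\<integral>\<^sup>+y. 0 \<partial>conv_power (symmetrized \<mu>) q')"
  proof (intro nn_integral_cong)
    fix y :: real
    have "(\<integral>\<^sup>+z. indicator {0} (y + z) \<partial>symmetrized \<mu>) = (\<integral>\<^sup>+z. indicator {- y} z \<partial>symmetrized \<mu>)"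
      by (intro nn_integral_cong) (auto simp: indicator_def)
    then show "(\<integral>\<^sup>+z. indicator {0} (y + z) \<partial>symmetrized \<mu>) = 0"
      using atom by simp
  qed
  finally show ?thesis by simp
qed (use assms in simp)

lemma real_distribution_difference:
  assumes "real_distribution \<nu>"
  shows "real_distribution (difference \<nu>)"
proof -
  interpret real_distribution \<nu> by fact
  have "real_distribution (negative \<nu>)"
    unfolding negative_def by (rule real_distribution_distr) simp
  then show ?thesis
    unfolding difference_def by (intro real_distribution_convolution assms)
qed

section \<open>Sums of thinned values\<close>

lemma nn_integral_binomial_Suc:
  assumes "0 \<le> r" "r \<le> 1"
  shows "(\<integral>\<^sup>+q. g q \<partial>measure_pmf (binomial_pmf (Suc n) r)) =
    (\<integral>\<^sup>+q. ennreal (1 - r) * g q + ennreal r * g (Suc q) \<partial>measure_pmf (binomial_pmf n r))"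
  using assms
  by (simp add: binomial_pmf_Suc nn_integral_add nn_integral_cmult nn_integral_multc ac_simps)

text \<open>
  Induction on the index set. Adding one index replaces \<open>f\<close> by its average \<open>K\<close> over one
  thinned value, and by \<open>thin\<close> this average is a two-point mixture of \<open>f\<close> and a convolution of \<open>f\<close>
  with \<open>\<mu>'\<close>: one more Bernoulli trial in the binomial count of surviving values.
\<close>

lemma nn_integral_thinned_sum:
  assumes \<mu>: "real_distribution \<mu>" and \<epsilon>: "real_distribution \<epsilon>" and \<mu>': "real_distribution \<mu>'"
    and r: "0 \<le> r" "r \<le> 1"
    and thin: "\<And>f. f \<in> borel_measurable borel \<Longrightarrow>
      (\<integral>\<^sup>+z. \<integral>\<^sup>+e. f (e * z) \<partial>\<epsilon> \<partial>\<mu>) = ennreal (1 - r) * f 0 + ennreal r * (\<integral>\<^sup>+y. f y \<partial>\<mu>')"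
    and "finite T" and "f \<in> borel_measurable borel"
  shows "(\<integral>\<^sup>+z. \<integral>\<^sup>+e. f (\<Sum>j\<in>T. e j * z j) \<partial>PiM T (\<lambda>_. \<epsilon>) \<partial>PiM T (\<lambda>_. \<mu>)) =
    (\<integral>\<^sup>+q. (\<integral>\<^sup>+y. f y \<partial>conv_power \<mu>' q) \<partial>measure_pmf (binomial_pmf (card T) r))"
  using assms(7,8)
proof (induction T arbitrary: f)
  case empty
  then have [measurable]: "f \<in> borel_measurable borel" by simp
  show ?case
    using r by (simp add: PiM_empty nn_integral_count_space_finite binomial_pmf_0 nn_integral_return)
next
  case (insert t T)
  interpret \<mu>: real_distribution \<mu> by fact
  interpret \<epsilon>: real_distribution \<epsilon> by fact
  interpret \<mu>': real_distribution \<mu>' by fact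
  interpret P\<mu>: product_prob_space "\<lambda>_. \<mu>" T ..
  interpret P\<epsilon>: product_prob_space "\<lambda>_. \<epsilon>" T ..
  interpret P\<epsilon>': product_prob_space "\<lambda>_. \<epsilon>" "insert t T" ..
  interpret Q: pair_prob_space \<mu> "PiM T (\<lambda>_. \<epsilon>)" ..
  have [measurable]: "f \<in> borel_measurable borel" by fact
  define K where "K c = (\<integral>\<^sup>+z. \<integral>\<^sup>+e. f (c + e * z) \<partial>\<epsilon> \<partial>\<mu>)" for c
  have [measurable]: "K \<in> borel_measurable borel"
    unfolding K_def by measurable
  have K: "K c = ennreal (1 - r) * f c + ennreal r * (\<integral>\<^sup>+y. f (c + y) \<partial>\<mu>')" for c
    unfolding K_def by (subst thin[of "\<lambda>y. f (c + y)"]) simp_all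
  have sum: "(\<Sum>j\<in>insert t T. (e(t := e')) j * (z(t := z')) j) = (\<Sum>j\<in>T. e j * z j) + e' * z'"
    for e z :: "'a \<Rightarrow> real" and e' z'
  proof -
    have "(\<Sum>j\<in>T. (e(t := e')) j * (z(t := z')) j) = (\<Sum>j\<in>T. e j * z j)"
      using insert.hyps by (intro sum.cong) auto
    then show ?thesis using insert.hyps by (simp add: add.commute)
  qed
  have "(\<integral>\<^sup>+z. \<integral>\<^sup>+e. f (\<Sum>j\<in>insert t T. e j * z j) \<partial>PiM (insert t T) (\<lambda>_. \<epsilon>) \<partial>PiM (insert t T) (\<lambda>_. \<mu>)) =
    (\<integral>\<^sup>+z. \<integral>\<^sup>+z'. \<integral>\<^sup>+e. f (\<Sum>j\<in>insert t T. e j * (z(t := z')) j) \<partial>PiM (insert t T) (\<lambda>_. \<epsilon>) \<partial>\<mu> \<partial>PiM T (\<lambda>_. \<mu>))"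
    by (rule P\<mu>.product_nn_integral_insert[OF insert.hyps]) measurable
  also have "\<dots> = (\<integral>\<^sup>+z. \<integral>\<^sup>+z'. \<integral>\<^sup>+e. \<integral>\<^sup>+e'. f ((\<Sum>j\<in>T. e j * z j) + e' * z')
      \<partial>\<epsilon> \<partial>PiM T (\<lambda>_. \<epsilon>) \<partial>\<mu> \<partial>PiM T (\<lambda>_. \<mu>))"
    by (intro nn_integral_cong) (subst P\<epsilon>.product_nn_integral_insert[OF insert.hyps], measurable, simp only: sum)
  also have "\<dots> = (\<integral>\<^sup>+z. \<integral>\<^sup>+e. K (\<Sum>j\<in>T. e j * z j) \<partial>PiM T (\<lambda>_. \<epsilon>) \<partial>PiM T (\<lambda>_. \<mu>))"
    unfolding K_def
  proof (intro nn_integral_cong)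
    fix z
    show "(\<integral>\<^sup>+z'. \<integral>\<^sup>+e. \<integral>\<^sup>+e'. f ((\<Sum>j\<in>T. e j * z j) + e' * z') \<partial>\<epsilon> \<partial>PiM T (\<lambda>_. \<epsilon>) \<partial>\<mu>) =
        (\<integral>\<^sup>+e. \<integral>\<^sup>+z'. \<integral>\<^sup>+e'. f ((\<Sum>j\<in>T. e j * z j) + e' * z') \<partial>\<epsilon> \<partial>\<mu> \<partial>PiM T (\<lambda>_. \<epsilon>))"
      by (rule Q.Fubini'[symmetric]) measurable
  qed
  also have "\<dots> = (\<integral>\<^sup>+q. (\<integral>\<^sup>+y. K y \<partial>conv_power \<mu>' q) \<partial>measure_pmf (binomial_pmf (card T) r))"
    by (rule insert.IH) simp
  also have "\<dots> = (\<integral>\<^sup>+q. ennreal (1 - r) * (\<integral>\<^sup>+y. f y \<partial>conv_power \<mu>' q) +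
      ennreal r * (\<integral>\<^sup>+y. f y \<partial>conv_power \<mu>' (Suc q)) \<partial>measure_pmf (binomial_pmf (card T) r))"
  proof (intro nn_integral_cong)
    fix q
    interpret C: real_distribution "conv_power \<mu>' q"
      using \<mu>' by (rule real_distribution_conv_power)
    show "(\<integral>\<^sup>+y. K y \<partial>conv_power \<mu>' q) = ennreal (1 - r) * (\<integral>\<^sup>+y. f y \<partial>conv_power \<mu>' q) +
      ennreal r * (\<integral>\<^sup>+y. f y \<partial>conv_power \<mu>' (Suc q))"
      unfolding K
      by (simp add: nn_integral_add nn_integral_cmult
          nn_integral_convolution_distribution[OF C.real_distribution_axioms \<mu>'])
  qed
  also have "\<dots> = (\<integral>\<^sup>+q. (\<integral>\<^sup>+y. f y \<partial>conv_power \<mu>' q) \<partial>measure_pmf (binomial_pmf (card (insert t T)) r))"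
    using r insert.hyps by (simp add: nn_integral_binomial_Suc)
  finally show ?case .
qed

section \<open>Values of mixtures of densities\<close>

text \<open>
  The version of the density that determines the value varies with the point, so uncountably many
  exceptional null sets are involved. If the value at \<open>\<omega>\<close> is below \<open>g \<omega>\<close>, a rational \<open>a\<close> separates
  the two, and by continuity of the version used at \<open>\<omega>\<close> the fixed version \<open>g\<close> is at most \<open>a\<close> almost
  everywhere on an interval around \<open>\<omega>\<close> with rational ends. So \<open>\<omega>\<close> lies in the null set where \<open>g\<close>
  exceeds \<open>a\<close> on that interval, one of countably many. The other inequality is symmetric.
\<close>

lemma AE_density_at_eq:
  assumes g [measurable]: "g \<in> borel_measurable borel" and \<kappa>: "\<kappa> = density lborel g"
  shows "AE \<omega> in lborel. density_at \<kappa> \<omega> = g \<omega>"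
proof -
  define below where "below p q a \<longleftrightarrow>
    (AE s in lborel. s \<in> {real_of_rat p<..<real_of_rat q} \<longrightarrow> g s \<le> ennreal (real_of_rat a))"
    for p q a
  define above where "above p q a \<longleftrightarrow>
    (AE s in lborel. s \<in> {real_of_rat p<..<real_of_rat q} \<longrightarrow> ennreal (real_of_rat a) \<le> g s)"
    for p q a
  have "AE \<omega> in lborel. \<forall>p q a. below p q a \<longrightarrow>
      \<omega> \<in> {real_of_rat p<..<real_of_rat q} \<longrightarrow> g \<omega> \<le> ennreal (real_of_rat a)"
    unfolding AE_all_countable below_def by (intro allI AE_impI)
  moreover have "AE \<omega> in lborel. \<forall>p q a. above p q a \<longrightarrow>
      \<omega> \<in> {real_of_rat p<..<real_of_rat q} \<longrightarrow> ennreal (real_of_rat a) \<le> g \<omega>"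
    unfolding AE_all_countable above_def by (intro allI AE_impI)
  moreover have "AE \<omega> in lborel. g \<omega> = RN_deriv lborel \<kappa> \<omega>"
    by (rule sigma_finite_measure.RN_deriv_unique[OF lborel.sigma_finite_measure_axioms]) (simp_all add: \<kappa>)
  ultimately show ?thesis
  proof eventually_elim
    case (elim \<omega>)
    show ?case
    proof (cases "has_cont_density_at \<kappa> \<omega>")
      case False
      then show ?thesis using elim by (simp add: density_at_def)
    next
      case True
      then obtain f where f: "is_cont_density \<kappa> \<omega> f"
        by (auto simp: has_cont_density_at_def)
      then have [measurable]: "f \<in> borel_measurable borel"
        by (auto simp: is_cont_density_def)
      have nn: "0 \<le> f t" for t
        using f by (auto simp: is_cont_density_def)
      have "density lborel g = density lborel (\<lambda>t. ennreal (f t))"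
        using f by (simp add: is_cont_density_def \<kappa>)
      then have ae: "AE t in lborel. g t = ennreal (f t)"
        by (subst (asm) sigma_finite_measure.density_unique_iff[OF lborel.sigma_finite_measure_axioms]) auto
      have near: "\<exists>p q. \<omega> \<in> {real_of_rat p<..<real_of_rat q} \<and> (\<forall>s\<in>{real_of_rat p<..<real_of_rat q}. f s \<in> S)"
        if "open S" "f \<omega> \<in> S" for S
      proof -
        have "(f \<longlongrightarrow> f \<omega>) (nhds \<omega>)"
          using f by (simp add: is_cont_density_def isCont_def tendsto_at_iff_tendsto_nhds)
        then have "\<forall>\<^sub>F s in nhds \<omega>. f s \<in> S"
          using that by (intro topological_tendstoD) simp_all
        then obtain e where e: "e > 0" "\<And>s. dist s \<omega> < e \<Longrightarrow> f s \<in> S"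
          unfolding eventually_nhds_metric by auto
        obtain p q where "\<omega> - e < real_of_rat p" "real_of_rat p < \<omega>" "\<omega> < real_of_rat q" "real_of_rat q < \<omega> + e"
          using of_rat_dense[of "\<omega> - e" \<omega>] of_rat_dense[of \<omega> "\<omega> + e"] e(1) by auto
        then show ?thesis
          by (intro exI[of _ p] exI[of _ q]) (auto intro!: e(2) simp: dist_real_def)
      qed
      have "g \<omega> = ennreal (f \<omega>)"
      proof (rule antisym; rule ccontr)
        assume "\<not> g \<omega> \<le> ennreal (f \<omega>)"
        then obtain a where a: "ennreal (f \<omega>) < ennreal (real_of_rat a)" "ennreal (real_of_rat a) < g \<omega>"
          using ennreal_rat_dense[of "ennreal (f \<omega>)" "g \<omega>"] by (auto simp: not_le)
        then have "f \<omega> < real_of_rat a"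
          using nn by (simp add: ennreal_less_iff)
        with near[of "{..<real_of_rat a}"] obtain p q where pq: "\<omega> \<in> {real_of_rat p<..<real_of_rat q}"
            "\<And>s. s \<in> {real_of_rat p<..<real_of_rat q} \<Longrightarrow> f s < real_of_rat a"
          by auto
        have "below p q a"
          unfolding below_def using ae
          by eventually_elim (auto intro!: ennreal_leI less_imp_le[OF pq(2)])
        then have "g \<omega> \<le> ennreal (real_of_rat a)" using elim(1) pq(1) by blast
        with a(2) show False by simp
      next
        assume "\<not> ennreal (f \<omega>) \<le> g \<omega>"
        then obtain a where a: "g \<omega> < ennreal (real_of_rat a)" "ennreal (real_of_rat a) < ennreal (f \<omega>)"
          using ennreal_rat_dense[of "g \<omega>" "ennreal (f \<omega>)"] by (auto simp: not_le)
        then have "real_of_rat a < f \<omega>"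
          using ennreal_leI[of "f \<omega>" "real_of_rat a"] by (auto simp: not_le[symmetric])
        with near[of "{real_of_rat a<..}"] obtain p q where pq: "\<omega> \<in> {real_of_rat p<..<real_of_rat q}"
            "\<And>s. s \<in> {real_of_rat p<..<real_of_rat q} \<Longrightarrow> real_of_rat a < f s"
          by auto
        have "above p q a"
          unfolding above_def using ae
          by eventually_elim (auto intro!: ennreal_leI less_imp_le[OF pq(2)])
        then have "ennreal (real_of_rat a) \<le> g \<omega>" using elim(2) pq(1) by blast
        with a(1) show False by simp
      qed
      then show ?thesis using density_at_eq[OF f] by simp
    qed
  qed
qed

lemma nn_integral_pmf_nat:
  "(\<integral>\<^sup>+q. a q \<partial>measure_pmf p) = (\<Sum>q. ennreal (pmf p q) * a q)" for p :: "nat pmf"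
  by (simp add: nn_integral_measure_pmf nn_integral_count_space_nat)

lemma mixture_density:
  fixes p :: "nat pmf"
  assumes sets: "sets L = sets borel"
    and L: "\<And>B. B \<in> sets borel \<Longrightarrow> emeasure L B = (\<integral>\<^sup>+q. emeasure (\<kappa> q) B \<partial>measure_pmf p)"
    and [measurable]: "\<And>q. g q \<in> borel_measurable borel"
    and \<kappa>: "\<And>q. \<kappa> q = density lborel (g q)"
  shows "L = density lborel (\<lambda>t. \<integral>\<^sup>+q. g q t \<partial>measure_pmf p)"
proof (rule measure_eqI)
  fix B assume "B \<in> sets L"
  then have B [measurable]: "B \<in> sets borel" using sets by simp
  have "emeasure L B = (\<Sum>q. ennreal (pmf p q) * (\<integral>\<^sup>+t. g q t * indicator B t \<partial>lborel))"
    by (simp add: L B nn_integral_pmf_nat \<kappa> emeasure_density)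
  also have "\<dots> = (\<integral>\<^sup>+t. (\<Sum>q. ennreal (pmf p q) * (g q t * indicator B t)) \<partial>lborel)"
    by (simp add: nn_integral_suminf nn_integral_cmult)
  also have "\<dots> = emeasure (density lborel (\<lambda>t. \<integral>\<^sup>+q. g q t \<partial>measure_pmf p)) B"
    by (simp add: emeasure_density nn_integral_pmf_nat mult.assoc[symmetric])
  finally show "emeasure L B = emeasure (density lborel (\<lambda>t. \<integral>\<^sup>+q. g q t \<partial>measure_pmf p)) B" .
qed (simp add: sets)

text \<open>
  Finiteness of the support is essential: an infinite sum of densities that are continuous at
  \<open>\<omega>\<close> need not be continuous there.
\<close>

lemma density_at_finite_mixture:
  fixes p :: "nat pmf"
  assumes sets: "sets L = sets borel"
    and L: "\<And>B. B \<in> sets borel \<Longrightarrow> emeasure L B = (\<integral>\<^sup>+q. emeasure (\<kappa> q) B \<partial>measure_pmf p)"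
    and fin: "finite (set_pmf p)" and cont: "\<And>q. has_cont_density_at (\<kappa> q) \<omega>"
  shows "density_at L \<omega> = (\<integral>\<^sup>+q. density_at (\<kappa> q) \<omega> \<partial>measure_pmf p)"
proof -
  obtain f where f: "\<And>q. is_cont_density (\<kappa> q) \<omega> (f q)"
    using cont unfolding has_cont_density_at_def by metis
  then have [measurable]: "\<And>q. f q \<in> borel_measurable borel"
    and nn: "\<And>q t. 0 \<le> f q t" and \<kappa>: "\<And>q. \<kappa> q = density lborel (\<lambda>t. ennreal (f q t))"
    and cont: "\<And>q. isCont (f q) \<omega>"
    by (simp_all add: is_cont_density_def)
  define F where "F t = (\<Sum>q\<in>set_pmf p. f q t * pmf p q)" for t
  have F: "(\<integral>\<^sup>+q. ennreal (f q t) \<partial>measure_pmf p) = ennreal (F t)" for t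
    unfolding F_def using fin nn
    by (subst nn_integral_measure_pmf_finite)
       (simp_all add: ennreal_mult'[symmetric] sum_ennreal mult.commute)
  have "is_cont_density L \<omega> F"
    unfolding is_cont_density_def
  proof (intro conjI allI)
    show "F \<in> borel_measurable borel" unfolding F_def by measurable
    show "0 \<le> F t" for t unfolding F_def by (intro sum_nonneg mult_nonneg_nonneg nn) simp
    show "isCont F \<omega>" unfolding F_def by (intro continuous_intros cont)
    show "L = density lborel (\<lambda>t. ennreal (F t))"
      using mixture_density[OF sets L _ \<kappa>] by (simp add: F)
  qed
  then show ?thesis
    by (simp add: density_at_eq[OF f] density_at_eq F)
qed

lemma AE_density_at_mixture:
  fixes p :: "nat pmf"
  assumes sets: "sets L = sets borel"
    and L: "\<And>B. B \<in> sets borel \<Longrightarrow> emeasure L B = (\<integral>\<^sup>+q. emeasure (\<kappa> q) B \<partial>measure_pmf p)"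
    and \<kappa>: "\<And>q. absolutely_continuous lborel (\<kappa> q)" "\<And>q. sets (\<kappa> q) = sets borel"
  shows "AE \<omega> in lborel. density_at L \<omega> = (\<integral>\<^sup>+q. density_at (\<kappa> q) \<omega> \<partial>measure_pmf p)"
proof -
  define g where "g q = RN_deriv lborel (\<kappa> q)" for q
  have g: "g q \<in> borel_measurable borel" "\<kappa> q = density lborel (g q)" for q
    using sigma_finite_measure.density_RN_deriv[OF lborel.sigma_finite_measure_axioms, of "\<kappa> q"] \<kappa>[of q] borel_measurable_RN_deriv[of lborel "\<kappa> q"]
    by (simp_all add: g_def)
  note [measurable] = g(1)
  have "AE \<omega> in lborel. density_at L \<omega> = (\<integral>\<^sup>+q. g q \<omega> \<partial>measure_pmf p)"
    by (rule AE_density_at_eq[OF _ mixture_density[OF sets L g]]) (simp_all add: nn_integral_pmf_nat)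
  moreover have "AE \<omega> in lborel. \<forall>q. density_at (\<kappa> q) \<omega> = g q \<omega>"
    unfolding AE_all_countable using g by (intro allI AE_density_at_eq)
  ultimately show ?thesis
    by eventually_elim simp
qed

section \<open>The Poisson limit of binomial mixtures\<close>

text \<open>
  Nothing is assumed about the size of \<open>a\<close>, so the limiting series may diverge; Fatou's lemma
  covers that case and dominated convergence the other. The bound by a multiple of \<open>\<beta>\<close> also
  forces \<open>b n q\<close> to vanish where \<open>\<beta> q = 0\<close>, which matters if \<open>a q = \<infinity>\<close>.
\<close>

lemma weighted_suminf_tendsto:
  fixes b :: "nat \<Rightarrow> nat \<Rightarrow> ennreal"
  assumes lim: "\<And>q. (\<lambda>n. b n q) \<longlonglongrightarrow> \<beta> q" and fin: "\<And>q. \<beta> q < \<infinity>" "C < \<infinity>"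
    and dom: "\<forall>\<^sub>F n in sequentially. \<forall>q. b n q \<le> C * \<beta> q"
  shows "(\<lambda>n. \<Sum>q. b n q * a q) \<longlonglongrightarrow> (\<Sum>q. \<beta> q * a q)"
proof -
  have termwise: "(\<lambda>n. b n q * a q) \<longlonglongrightarrow> \<beta> q * a q" for q
  proof (cases "\<beta> q = 0")
    case True
    have "\<forall>\<^sub>F n in sequentially. b n q * a q = 0"
      using dom by eventually_elim (use True in \<open>metis le_zero_eq mult_zero_left mult_zero_right\<close>)
    then show ?thesis using True by (simp add: tendsto_eventually)
  next
    case False
    then show ?thesis using fin(1)[of q] by (intro tendsto_mult_ennreal lim) auto
  qed
  show ?thesis
  proof (cases "(\<Sum>q. \<beta> q * a q) = \<infinity>")
    case True
    have "(\<integral>\<^sup>+q. liminf (\<lambda>n. b n q * a q) \<partial>count_space UNIV) \<le>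
        liminf (\<lambda>n. \<integral>\<^sup>+q. b n q * a q \<partial>count_space UNIV)"
      by (rule nn_integral_liminf) simp
    also have "(\<lambda>q. liminf (\<lambda>n. b n q * a q)) = (\<lambda>q. \<beta> q * a q)"
      using termwise by (auto intro!: lim_imp_Liminf)
    finally have "liminf (\<lambda>n. \<Sum>q. b n q * a q) = \<infinity>"
      using True by (simp add: nn_integral_count_space_nat top_unique)
    moreover have "liminf (\<lambda>n. \<Sum>q. b n q * a q) \<le> limsup (\<lambda>n. \<Sum>q. b n q * a q)"
      by (intro Liminf_le_Limsup sequentially_bot)
    ultimately show ?thesis
      using True by (intro Liminf_eq_Limsup) (simp_all add: top_unique)
  next
    case False
    obtain N where N: "\<And>n q. n \<ge> N \<Longrightarrow> b n q \<le> C * \<beta> q"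
      using dom by (auto simp: eventually_sequentially)
    have "(\<lambda>n. \<integral>\<^sup>+q. b (n + N) q * a q \<partial>count_space UNIV) \<longlonglongrightarrow> (\<integral>\<^sup>+q. \<beta> q * a q \<partial>count_space UNIV)"
    proof (rule nn_integral_dominated_convergence[where w = "\<lambda>q. C * (\<beta> q * a q)"])
      show "AE q in count_space UNIV. b (n + N) q * a q \<le> C * (\<beta> q * a q)" for n
        using N[of "n + N"] by (auto simp: mult.assoc[symmetric] intro!: mult_right_mono)
      show "(\<integral>\<^sup>+q. C * (\<beta> q * a q) \<partial>count_space UNIV) < \<infinity>"
        using False fin(2)
        by (simp add: nn_integral_cmult nn_integral_count_space_nat ennreal_mult_less_top less_top)
      show "AE q in count_space UNIV. (\<lambda>n. b (n + N) q * a q) \<longlonglongrightarrow> \<beta> q * a q"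
        by (intro AE_I2 LIMSEQ_ignore_initial_segment termwise)
    qed simp_all
    then show ?thesis
      by (simp only: nn_integral_count_space_nat) (rule LIMSEQ_offset)
  qed
qed

lemma binomial_weight_tendsto:
  fixes t :: "nat \<Rightarrow> real" and k :: "nat \<Rightarrow> nat"
  assumes k: "filterlim k at_top sequentially" and kt: "(\<lambda>n. real (k n) * t n) \<longlonglongrightarrow> c"
  shows "(\<lambda>n. real (k n choose q) * t n ^ q) \<longlonglongrightarrow> c ^ q / fact q"
proof -
  have k': "filterlim (\<lambda>n. real (k n)) at_top sequentially"
    using k by (rule filterlim_compose[OF filterlim_real_sequentially])
  have "(\<lambda>n. real (k n) * t n / real (k n)) \<longlonglongrightarrow> 0"
    by (rule real_tendsto_divide_at_top[OF kt k'])
  moreover have "\<forall>\<^sub>F n in sequentially. real (k n) * t n / real (k n) = t n"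
    using filterlim_at_top_dense[THEN iffD1, OF k', rule_format, of 0] by eventually_elim simp
  ultimately have t: "t \<longlonglongrightarrow> 0" by (rule Lim_transform_eventually)
  have "(\<lambda>n. (\<Prod>i=0..<q. real (k n) * t n - real i * t n) / fact q) \<longlonglongrightarrow> (\<Prod>i=0..<q. c - real i * 0) / fact q"
    by (intro tendsto_intros kt t) simp
  moreover have "real (k n choose q) * t n ^ q = (\<Prod>i=0..<q. real (k n) * t n - real i * t n) / fact q" for n
    by (simp add: binomial_gbinomial gbinomial_prod_rev left_diff_distrib[symmetric] prod.distrib)
  ultimately show ?thesis by simp
qed

text \<open>
  The bound is relative to the limiting weight and uniform in \<open>q\<close>. Replacing \<open>k * t\<close> by \<open>c\<close>
  costs a factor \<open>(1 + K / k) ^ q\<close>, which stays bounded because the weight vanishes for \<open>q > k\<close>.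
\<close>

lemma binomial_weight_le:
  fixes t c K :: real
  assumes "0 \<le> t" "0 \<le> c" "0 \<le> K" "0 < k" and kt: "real k * t \<le> c * (1 + K / real k)"
  shows "real (k choose q) * t ^ q \<le> exp K * (c ^ q / fact q)"
proof (cases "q \<le> k")
  case True
  have "real (k choose q) * fact q \<le> real k ^ q"
    using binomial_fact_pow[of k q] by (metis of_nat_fact of_nat_le_iff of_nat_mult of_nat_power)
  then have "real (k choose q) * fact q * t ^ q \<le> real k ^ q * t ^ q"
    using assms by (intro mult_right_mono) simp_all
  also have "\<dots> = (real k * t) ^ q"
    by (simp add: power_mult_distrib)
  also have "\<dots> \<le> (c * (1 + K / real k)) ^ q"
    using assms by (intro power_mono) auto
  also have "\<dots> = c ^ q * (1 + K / real k) ^ q"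
    by (rule power_mult_distrib)
  also have "\<dots> \<le> c ^ q * (1 + K / real k) ^ k"
    using True assms by (intro mult_left_mono power_increasing) auto
  also have "\<dots> \<le> c ^ q * exp K"
    using assms by (intro mult_left_mono exp_ge_one_plus_x_over_n_power_n) auto
  finally show ?thesis
    by (simp add: field_simps)
qed (use assms in \<open>simp add: binomial_eq_0\<close>)

text \<open>
  Dividing the binomial weights by the weight of \<open>0\<close> turns probabilities into odds, and
  the factor \<open>(1 - r) ^ k\<close> cancels from the quotient.
\<close>

lemma binomial_zero_fraction:
  assumes r: "0 \<le> r" "r < 1"
  shows "a 0 * ennreal ((1 - r) ^ k) / (\<integral>\<^sup>+q. a q \<partial>measure_pmf (binomial_pmf k r)) =
    a 0 / (\<Sum>q. ennreal (real (k choose q) * (r / (1 - r)) ^ q) * a q)"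
proof -
  have pmf: "ennreal (pmf (binomial_pmf k r) q) =
      ennreal ((1 - r) ^ k) * ennreal (real (k choose q) * (r / (1 - r)) ^ q)" for q
  proof (cases "q \<le> k")
    case True
    then have "(1 - r) ^ k = (1 - r) ^ q * (1 - r) ^ (k - q)"
      by (simp flip: power_add)
    then show ?thesis
      using r by (simp add: ennreal_mult'[symmetric] power_divide field_simps)
  qed (use r in \<open>simp add: binomial_eq_0\<close>)
  have "(\<integral>\<^sup>+q. a q \<partial>measure_pmf (binomial_pmf k r)) =
      ennreal ((1 - r) ^ k) * (\<Sum>q. ennreal (real (k choose q) * (r / (1 - r)) ^ q) * a q)"
    by (simp only: nn_integral_pmf_nat pmf mult.assoc ennreal_suminf_cmult)
  moreover have "ennreal ((1 - r) ^ k) \<noteq> 0" "ennreal ((1 - r) ^ k) \<noteq> \<infinity>"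
    using r by (simp_all add: ennreal_eq_0_iff not_le)
  ultimately show ?thesis
    by (simp only: mult.commute[of "ennreal ((1 - r) ^ k)"] divide_mult_eq not_False_eq_True)
qed

lemma binomial_zero_fraction_tendsto:
  fixes r :: "nat \<Rightarrow> real" and k :: "nat \<Rightarrow> nat"
  assumes "0 \<le> c" "0 \<le> K" and r: "\<forall>\<^sub>F n in sequentially. 0 \<le> r n \<and> r n < 1"
    and k: "filterlim k at_top sequentially"
    and lim: "(\<lambda>n. real (k n) * (r n / (1 - r n))) \<longlonglongrightarrow> c"
    and dom: "\<forall>\<^sub>F n in sequentially. real (k n) * (r n / (1 - r n)) \<le> c * (1 + K / real (k n))"
  shows "(\<lambda>n. a 0 * ennreal ((1 - r n) ^ k n) / (\<integral>\<^sup>+q. a q \<partial>measure_pmf (binomial_pmf (k n) (r n))))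
    \<longlonglongrightarrow> a 0 / (\<Sum>q. ennreal (c ^ q / fact q) * a q)"
proof -
  define b where "b n q = ennreal (real (k n choose q) * (r n / (1 - r n)) ^ q)" for n q
  have "(\<lambda>n. \<Sum>q. b n q * a q) \<longlonglongrightarrow> (\<Sum>q. ennreal (c ^ q / fact q) * a q)"
  proof (rule weighted_suminf_tendsto[where C = "ennreal (exp K)"])
    show "(\<lambda>n. b n q) \<longlonglongrightarrow> ennreal (c ^ q / fact q)" for q
      unfolding b_def by (intro tendsto_ennrealI binomial_weight_tendsto k lim)
    have "\<forall>\<^sub>F n in sequentially. 0 < k n"
      using eventually_compose_filterlim[OF eventually_gt_at_top[of 0] k] .
    with r dom show "\<forall>\<^sub>F n in sequentially. \<forall>q. b n q \<le> ennreal (exp K) * ennreal (c ^ q / fact q)"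
    proof eventually_elim
      case (elim n)
      then show ?case
        unfolding b_def using assms(1,2)
        by (auto simp: ennreal_mult'[symmetric] simp del: times_divide_eq_right intro!: ennreal_leI binomial_weight_le)
    qed
  qed simp_all
  moreover have ev: "\<forall>\<^sub>F n in sequentially. a 0 / (\<Sum>q. b n q * a q) =
      a 0 * ennreal ((1 - r n) ^ k n) / (\<integral>\<^sup>+q. a q \<partial>measure_pmf (binomial_pmf (k n) (r n)))"
    using r unfolding b_def by eventually_elim (simp only: binomial_zero_fraction)
  ultimately show ?thesis
  proof (cases "a 0 = 0 \<or> a 0 = \<infinity>")
    case True
    \<comment> \<open>If \<open>a 0 = \<infinity>\<close> then both denominators are infinite, and \<open>\<infinity> / \<infinity> = 0\<close>.\<close>
    have zero: "a 0 / S = 0" if "a 0 \<le> S" for S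
      using True that by (auto simp: divide_ennreal_def top_unique)
    moreover have "a 0 \<le> (\<Sum>q. b n q * a q)" for n
      using sum_le_suminf[of "\<lambda>q. b n q * a q" "{0}"] by (simp add: b_def)
    moreover have "a 0 \<le> (\<Sum>q. ennreal (c ^ q / fact q) * a q)"
      using sum_le_suminf[of "\<lambda>q. ennreal (c ^ q / fact q) * a q" "{0}"] by simp
    ultimately have "(\<lambda>n. a 0 / (\<Sum>q. b n q * a q)) \<longlonglongrightarrow> a 0 / (\<Sum>q. ennreal (c ^ q / fact q) * a q)"
      by (simp only: zero tendsto_const)
    then show ?thesis using ev by (rule Lim_transform_eventually)
  next
    case False
    have "continuous_on UNIV (inverse :: ennreal \<Rightarrow> ennreal)"
      by (intro continuous_intros)
    then have "((\<lambda>n. inverse (\<Sum>q. b n q * a q)) \<longlongrightarrow> inverse (\<Sum>q. ennreal (c ^ q / fact q) * a q)) sequentially"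
      using \<open>(\<lambda>n. \<Sum>q. b n q * a q) \<longlonglongrightarrow> _\<close> by (auto intro: continuous_on_tendsto_compose)
    then have "(\<lambda>n. a 0 / (\<Sum>q. b n q * a q)) \<longlonglongrightarrow> a 0 / (\<Sum>q. ennreal (c ^ q / fact q) * a q)"
      unfolding divide_ennreal_def using False by (intro tendsto_mult_ennreal tendsto_const) auto
    then show ?thesis using ev by (rule Lim_transform_eventually)
  qed
qed

text \<open>
  The assumption on \<open>p\<close> is the form that Bayes' rule takes when the event has probability
  \<open>(1 - r) ^ k\<close> and leaves only noise. All three modes of convergence reduce to the single claim
  that taking the value at \<open>\<omega>\<close> commutes with the mixture, from some \<open>n\<close> on.
\<close>

lemma bayes_tendsto_poisson_ratio:
  fixes r :: "nat \<Rightarrow> real" and k :: "nat \<Rightarrow> nat"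
    and p :: "(real measure \<Rightarrow> real \<Rightarrow> ennreal) \<Rightarrow> nat \<Rightarrow> real \<Rightarrow> ennreal"
  assumes \<kappa>: "real_distribution \<kappa>" and \<mu>: "real_distribution \<mu>"
    and c: "0 \<le> c" "0 \<le> K" and r: "\<forall>\<^sub>F n in sequentially. 0 \<le> r n \<and> r n < 1"
    and k: "filterlim k at_top sequentially"
    and lim: "(\<lambda>n. real (k n) * (r n / (1 - r n))) \<longlonglongrightarrow> c"
    and dom: "\<forall>\<^sub>F n in sequentially. real (k n) * (r n / (1 - r n)) \<le> c * (1 + K / real (k n))"
    and mixture: "\<forall>\<^sub>F n in sequentially. sets (\<Lambda> n) = sets borel \<and> (\<forall>B \<in> sets borel.
      emeasure (\<Lambda> n) B = (\<integral>\<^sup>+q. emeasure (convolution \<kappa> (conv_power \<mu> q)) B \<partial>measure_pmf (binomial_pmf (k n) (r n))))"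
    and p: "\<forall>\<^sub>F n in sequentially. \<forall>val \<omega>. p val n \<omega> = val \<kappa> \<omega> * ennreal ((1 - r n) ^ k n) / val (\<Lambda> n) \<omega>"
  shows "(absolutely_continuous lborel \<kappa> \<longrightarrow>
      (AE \<omega> in lborel. (\<lambda>n. p density_at n \<omega>) \<longlonglongrightarrow> poisson_ratio density_at c \<kappa> \<mu> \<omega>) \<and>
      (\<forall>\<omega>. (\<forall>q. has_cont_density_at (convolution \<kappa> (conv_power \<mu> q)) \<omega>) \<longrightarrow>
        (\<lambda>n. p density_at n \<omega>) \<longlonglongrightarrow> poisson_ratio density_at c \<kappa> \<mu> \<omega>)) \<and>
    (\<forall>\<omega>. (\<lambda>n. p mass_at n \<omega>) \<longlonglongrightarrow> poisson_ratio mass_at c \<kappa> \<mu> \<omega>)"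
proof -
  let ?b = "\<lambda>n. binomial_pmf (k n) (r n)" and ?\<kappa> = "\<lambda>q. convolution \<kappa> (conv_power \<mu> q)"
  have conv: "real_distribution (conv_power \<mu> q)" for q
    using \<mu> by (rule real_distribution_conv_power)
  have reduce: "(\<lambda>n. p val n \<omega>) \<longlonglongrightarrow> poisson_ratio val c \<kappa> \<mu> \<omega>"
    if ev: "\<forall>\<^sub>F n in sequentially. val (\<Lambda> n) \<omega> = (\<integral>\<^sup>+q. val (?\<kappa> q) \<omega> \<partial>measure_pmf (?b n))" for val \<omega>
  proof -
    have zero: "val (?\<kappa> 0) \<omega> = val \<kappa> \<omega>"
      by (simp add: convolution_return_zero[OF \<kappa>])
    have "(\<lambda>n. val (?\<kappa> 0) \<omega> * ennreal ((1 - r n) ^ k n) / (\<integral>\<^sup>+q. val (?\<kappa> q) \<omega> \<partial>measure_pmf (?b n)))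
        \<longlonglongrightarrow> val (?\<kappa> 0) \<omega> / (\<Sum>q. ennreal (c ^ q / fact q) * val (?\<kappa> q) \<omega>)"
      by (rule binomial_zero_fraction_tendsto[OF c r k lim dom])
    moreover have "\<forall>\<^sub>F n in sequentially. val (?\<kappa> 0) \<omega> * ennreal ((1 - r n) ^ k n) /
        (\<integral>\<^sup>+q. val (?\<kappa> q) \<omega> \<partial>measure_pmf (?b n)) = p val n \<omega>"
      using p ev by eventually_elim (simp only: zero)
    ultimately show ?thesis
      unfolding poisson_ratio_def zero by (rule Lim_transform_eventually)
  qed
  have "(\<lambda>n. p mass_at n \<omega>) \<longlonglongrightarrow> poisson_ratio mass_at c \<kappa> \<mu> \<omega>" for \<omega>
    using mixture by (intro reduce) (auto simp: mass_at_def elim!: eventually_mono)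
  moreover have "(\<lambda>n. p density_at n \<omega>) \<longlonglongrightarrow> poisson_ratio density_at c \<kappa> \<mu> \<omega>"
    if cont: "\<forall>q. has_cont_density_at (?\<kappa> q) \<omega>" for \<omega>
  proof (rule reduce)
    show "\<forall>\<^sub>F n in sequentially. density_at (\<Lambda> n) \<omega> = (\<integral>\<^sup>+q. density_at (?\<kappa> q) \<omega> \<partial>measure_pmf (?b n))"
      using mixture r
    proof eventually_elim
      case (elim n)
      show ?case
      proof (rule density_at_finite_mixture)
        show "finite (set_pmf (?b n))"
          by (rule finite_set_pmf_binomial_pmf) (use elim in auto)
      qed (use elim cont in auto)
    qed
  qed
  moreover have "AE \<omega> in lborel. (\<lambda>n. p density_at n \<omega>) \<longlonglongrightarrow> poisson_ratio density_at c \<kappa> \<mu> \<omega>"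
    if ac: "absolutely_continuous lborel \<kappa>"
  proof -
    obtain N where N: "\<And>n. N \<le> n \<Longrightarrow> sets (\<Lambda> n) = sets borel"
        "\<And>n B. N \<le> n \<Longrightarrow> B \<in> sets borel \<Longrightarrow> emeasure (\<Lambda> n) B = (\<integral>\<^sup>+q. emeasure (?\<kappa> q) B \<partial>measure_pmf (?b n))"
      using mixture unfolding eventually_sequentially by blast
    have "AE \<omega> in lborel. \<forall>n. density_at (\<Lambda> (n + N)) \<omega> = (\<integral>\<^sup>+q. density_at (?\<kappa> q) \<omega> \<partial>measure_pmf (?b (n + N)))"
      unfolding AE_all_countable
      by (intro allI AE_density_at_mixture absolutely_continuous_convolution \<kappa> conv ac) (auto intro!: N)
    then show ?thesis
    proof eventually_elim
      case (elim \<omega>)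
      have "\<forall>\<^sub>F n in sequentially. density_at (\<Lambda> n) \<omega> = (\<integral>\<^sup>+q. density_at (?\<kappa> q) \<omega> \<partial>measure_pmf (?b n))"
        using elim by (subst eventually_sequentially_seg[of _ N, symmetric]) simp
      then show ?case by (rule reduce)
    qed
  qed
  ultimately show ?thesis by blast
qed

text \<open>
  The rates \<open>r n\<close> are at most \<open>D / m\<close> and asymptotic to it. The error in \<open>k * t\<close> relative to \<open>D * \<rho>\<close>
  is the product of \<open>1 + 1 / (\<rho> * m)\<close>, as \<open>k\<close> exceeds \<open>\<rho> * m\<close> by less than \<open>1\<close>, and of
  \<open>1 + 2 * D / m\<close>, from the passage from probabilities to odds. Both are of order \<open>1 / m\<close>, hence of
  order \<open>1 / k\<close>, which is exactly what the domination of the binomial weights can absorb.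
\<close>

lemma sparse_rate:
  fixes r :: "nat \<Rightarrow> real" and k m :: "nat \<Rightarrow> nat"
  assumes \<rho>: "0 < \<rho>" and D: "0 \<le> D"
    and m: "filterlim m at_top sequentially"
    and k: "\<forall>\<^sub>F n in sequentially. \<bar>real (k n) - \<rho> * real (m n)\<bar> < 1 \<and> k n < m n"
    and r: "\<forall>\<^sub>F n in sequentially. 0 \<le> r n \<and> r n \<le> D / real (m n)"
    and mr: "(\<lambda>n. real (m n) * r n) \<longlonglongrightarrow> D"
  obtains K where "0 \<le> K" "filterlim k at_top sequentially"
    "\<forall>\<^sub>F n in sequentially. 0 \<le> r n \<and> r n < 1"
    "(\<lambda>n. real (k n) * (r n / (1 - r n))) \<longlonglongrightarrow> D * \<rho>"
    "\<forall>\<^sub>F n in sequentially. real (k n) * (r n / (1 - r n)) \<le> D * \<rho> * (1 + K / real (k n))"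
proof -
  \<comment> \<open>An upper bound for the terms of order \<open>1 / m\<close> in \<open>(1 + 1 / (\<rho> * m)) * (1 + 2 * D / m)\<close>, using \<open>1 / m \<le> 1\<close> for the last.\<close>
  define K where "K = 1 / \<rho> + 2 * D + 2 * D / \<rho>"
  have m': "filterlim (\<lambda>n. real (m n)) at_top sequentially"
    using m by (rule filterlim_compose[OF filterlim_real_sequentially])
  have m_large: "\<forall>\<^sub>F n in sequentially. C < real (m n)" for C
    using m' by (simp add: filterlim_at_top_dense)
  have k': "filterlim (\<lambda>n. real (k n)) at_top sequentially"
  proof (rule filterlim_at_top_mono)
    show "filterlim (\<lambda>n. -1 + \<rho> * real (m n)) at_top sequentially"
      by (intro filterlim_tendsto_add_at_top[OF tendsto_const] filterlim_tendsto_pos_mult_at_top[OF tendsto_const \<rho> m'])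
    show "\<forall>\<^sub>F n in sequentially. -1 + \<rho> * real (m n) \<le> real (k n)"
      using k by eventually_elim linarith
  qed
  have k_top: "filterlim k at_top sequentially"
    unfolding filterlim_at_top
  proof
    fix Z :: nat
    have "\<forall>\<^sub>F n in sequentially. real Z < real (k n)"
      using k'[unfolded filterlim_at_top_dense] by blast
    then show "\<forall>\<^sub>F n in sequentially. Z \<le> k n"
      by eventually_elim simp
  qed
  have "(\<lambda>n. real (m n) * r n / real (m n)) \<longlonglongrightarrow> 0"
    by (rule real_tendsto_divide_at_top[OF mr m'])
  moreover have "\<forall>\<^sub>F n in sequentially. real (m n) * r n / real (m n) = r n"
    using m_large[of 0] by eventually_elim simp
  ultimately have r0: "r \<longlonglongrightarrow> 0" by (rule Lim_transform_eventually)
  then have r1: "\<forall>\<^sub>F n in sequentially. 0 \<le> r n \<and> r n < 1"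
    using r order_tendstoD(2)[of r 0 sequentially 1] by (auto elim: eventually_elim2)
  have "(\<lambda>n. (real (k n) - \<rho> * real (m n)) / real (m n)) \<longlonglongrightarrow> 0"
  proof (rule tendsto_0_le[where K = 1])
    show "(\<lambda>n. 1 / real (m n)) \<longlonglongrightarrow> 0"
      by (rule real_tendsto_divide_at_top[OF tendsto_const m'])
    show "\<forall>\<^sub>F n in sequentially. norm ((real (k n) - \<rho> * real (m n)) / real (m n)) \<le> norm (1 / real (m n)) * 1"
      using k by eventually_elim (simp add: divide_right_mono)
  qed
  then have "(\<lambda>n. \<rho> + (real (k n) - \<rho> * real (m n)) / real (m n)) \<longlonglongrightarrow> \<rho> + 0"
    by (intro tendsto_add tendsto_const)
  then have "(\<lambda>n. (\<rho> + (real (k n) - \<rho> * real (m n)) / real (m n)) * (real (m n) * r n) / (1 - r n))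
      \<longlonglongrightarrow> (\<rho> + 0) * D / (1 - 0)"
    by (intro tendsto_divide tendsto_mult tendsto_diff mr r0 tendsto_const) simp_all
  note quotient = this
  have "\<forall>\<^sub>F n in sequentially. (\<rho> + (real (k n) - \<rho> * real (m n)) / real (m n)) * (real (m n) * r n) / (1 - r n) =
      real (k n) * (r n / (1 - r n))"
    using m_large[of 0] by eventually_elim (simp add: field_simps)
  from Lim_transform_eventually[OF quotient this]
  have lim: "(\<lambda>n. real (k n) * (r n / (1 - r n))) \<longlonglongrightarrow> D * \<rho>"
    by (simp add: mult.commute[of D])
  have "\<forall>\<^sub>F n in sequentially. 0 < k n"
    using eventually_compose_filterlim[OF eventually_gt_at_top[of 0] k_top] .
  with k r r1 m_large[of 1] m_large[of "2 * D"]
  have "\<forall>\<^sub>F n in sequentially. real (k n) * (r n / (1 - r n)) \<le> D * \<rho> * (1 + K / real (k n))"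
  proof eventually_elim
    case (elim n)
    define u where "u = 1 / real (m n)"
    have u: "0 < u" "u \<le> 1" "D * u \<le> 1 / 2" "u * real (m n) = 1"
      using elim D by (simp_all add: u_def field_simps)
    have "r n / (1 - r n) \<le> D * u / (1 - D * u)"
      using elim u by (intro frac_le) (simp_all add: u_def)
    also have "\<dots> \<le> D * u * (1 + 2 * (D * u))"
    proof -
      have "D * u * 1 \<le> D * u * ((1 + 2 * (D * u)) * (1 - D * u))"
      proof (rule mult_left_mono)
        have "0 \<le> (D * u) * (1 - 2 * (D * u))"
          using u D by (intro mult_nonneg_nonneg) auto
        then show "1 \<le> (1 + 2 * (D * u)) * (1 - D * u)"
          by (simp add: algebra_simps)
      qed (use u D in simp)
      then show ?thesis
        using u by (simp add: pos_divide_le_eq mult.assoc)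
    qed
    finally have t: "r n / (1 - r n) \<le> D * u * (1 + 2 * (D * u))" .
    have "real (k n) \<le> \<rho> * real (m n) + 1"
      using elim by linarith
    then have "real (k n) * (r n / (1 - r n)) \<le> (\<rho> * real (m n) + 1) * (D * u * (1 + 2 * (D * u)))"
      using t elim \<rho> by (intro mult_mono) auto
    also have "\<dots> = D * ((u * real (m n)) * \<rho> + u) * (1 + 2 * (D * u))"
      by (simp add: algebra_simps)
    also have "\<dots> = D * \<rho> * (1 + (1 / \<rho> + 2 * D + 2 * D / \<rho> * u) * u)"
      unfolding u(4) using \<rho> by (simp add: field_simps)
    also have "\<dots> \<le> D * \<rho> * (1 + K * u)"
      unfolding K_def using u D \<rho>
      by (intro mult_left_mono add_left_mono mult_right_mono mult_left_le) auto
    also have "\<dots> \<le> D * \<rho> * (1 + K * (1 / real (k n)))"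
      unfolding u_def using elim D \<rho>
      by (intro mult_left_mono add_left_mono divide_left_mono) (auto simp: K_def)
    finally show ?case by simp
  qed
  then show thesis
    using D \<rho> by (intro that[of K] k_top r1 lim) (auto simp: K_def)
qed

section \<open>Random supports and coefficients\<close>

text \<open>
  There are uncountably many sets of naturals, but only finitely many of them occur as supports,
  so measurability of the individual fibres suffices.
\<close>

lemma measurable_supp:
  assumes "\<And>j. j \<in> {1..N} \<Longrightarrow> (\<lambda>w. v w j) \<in> borel_measurable M"
  shows "(\<lambda>w. supp N (v w)) \<in> measurable M (count_space UNIV)"
proof (intro measurableI)
  fix S :: "nat set set"
  note [measurable] = assms
  have "(\<forall>j\<in>{1..N}. (v w j \<noteq> 0) = (j \<in> T)) \<longleftrightarrow> supp N (v w) = T" if "T \<subseteq> {1..N}" for w T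
    using that by (auto simp: supp_def)
  then have eq: "{w \<in> space M. supp N (v w) = T} = {w \<in> space M. \<forall>j\<in>{1..N}. (v w j \<noteq> 0) = (j \<in> T)}"
    if "T \<in> S \<inter> Pow {1..N}" for T
    using that by simp
  have "supp N (v w) \<in> Pow {1..N}" for w
    by (auto simp: supp_def)
  then have "(\<lambda>w. supp N (v w)) -` S \<inter> space M =
      (\<Union>T\<in>S \<inter> Pow {1..N}. {w \<in> space M. supp N (v w) = T})"
    by blast
  also have "\<dots> \<in> sets M"
  proof (rule sets.finite_UN)
    fix T assume T: "T \<in> S \<inter> Pow {1..N}"
    show "{w \<in> space M. supp N (v w) = T} \<in> sets M"
      unfolding eq[OF T] by measurable
  qed simp
  finally show "(\<lambda>w. supp N (v w)) -` S \<inter> space M \<in> sets M" .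
qed simp

text \<open>
  Removing \<open>a\<close> leaves an arbitrary \<open>(d - 1)\<close>-subset of \<open>X - {a}\<close>; the binomial absorption identity
  does the rest. The form without division and subtraction also covers \<open>d = 0\<close>.
\<close>

lemma card_nsets_containing:
  assumes "finite X" "a \<in> X"
  shows "card {S \<in> nsets X d. a \<in> S} * card X = d * (card X choose d)"
proof (cases d)
  case 0
  then have "{S \<in> nsets X d. a \<in> S} = {}" by (auto simp: nsets_def)
  then show ?thesis using 0 by simp
next
  case (Suc d')
  have "bij_betw (insert a) (nsets (X - {a}) d') {S \<in> nsets X d. a \<in> S}"
  proof (rule bij_betwI[where g = "\<lambda>S. S - {a}"])
    show "insert a \<in> nsets (X - {a}) d' \<rightarrow> {S \<in> nsets X d. a \<in> S}"
      using assms Suc by (auto simp: nsets_def card_insert_if)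
    show "(\<lambda>S. S - {a}) \<in> {S \<in> nsets X d. a \<in> S} \<rightarrow> nsets (X - {a}) d'"
      using Suc by (auto simp: nsets_def)
  qed (auto simp: nsets_def)
  from bij_betw_same_card[OF this]
  have "card {S \<in> nsets X d. a \<in> S} = (card X - 1 choose d')"
    using assms by simp
  then show ?thesis
    using binomial_absorption[of d' "card X"] Suc by (simp add: mult.commute)
qed

lemma prob_nsets_containing:
  assumes i: "i \<in> {1..m}" and d: "d < m"
  shows "measure_pmf.prob (pmf_of_set (nsets {1..m} d)) {S. i \<in> S} = real d / real m"
proof -
  have "nsets {1..m} d \<noteq> {}" "finite (nsets {1..m} d)"
    using d by (auto simp: nsets_eq_empty_iff intro: finite_imp_finite_nsets)
  then have "measure_pmf.prob (pmf_of_set (nsets {1..m} d)) {S. i \<in> S} =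
      real (card {S \<in> nsets {1..m} d. i \<in> S}) / real (m choose d)"
    by (simp add: measure_pmf_of_set Int_def)
  also have "real (card {S \<in> nsets {1..m} d. i \<in> S}) * real m = real d * real (m choose d)"
    using arg_cong[OF card_nsets_containing[of "{1..m}" i d], of real] i by simp
  then have "real (card {S \<in> nsets {1..m} d. i \<in> S}) / real (m choose d) = real d / real m"
    using d by (simp add: field_simps)
  finally show ?thesis .
qed

text \<open>
  A set that contains \<open>i1\<close> and avoids \<open>i2\<close> is a set in \<open>{1..m} - {i2}\<close> containing \<open>i1\<close>, which
  reduces the count to \<open>card_nsets_containing\<close> with \<open>m - 1\<close> points.
\<close>

lemma prob_nsets_separating:
  assumes i: "i1 \<in> {1..m}" "i2 \<in> {1..m}" "i1 \<noteq> i2" and d: "d < m"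
  shows "measure_pmf.prob (pmf_of_set (nsets {1..m} d)) {S. i1 \<in> S \<and> i2 \<notin> S} =
    real d * (real m - real d) / (real m * (real m - 1))"
proof -
  have m: "1 < m" using i by auto
  have "nsets {1..m} d \<noteq> {}" "finite (nsets {1..m} d)"
    using d by (auto simp: nsets_eq_empty_iff intro: finite_imp_finite_nsets)
  then have "measure_pmf.prob (pmf_of_set (nsets {1..m} d)) {S. i1 \<in> S \<and> i2 \<notin> S} =
      real (card (nsets {1..m} d \<inter> {S. i1 \<in> S \<and> i2 \<notin> S})) / real (m choose d)"
    by (simp add: measure_pmf_of_set)
  also have "nsets {1..m} d \<inter> {S. i1 \<in> S \<and> i2 \<notin> S} = {S \<in> nsets ({1..m} - {i2}) d. i1 \<in> S}"
    by (auto simp: nsets_def)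
  also have "real (card \<dots>) / real (m choose d) = real d * (real m - real d) / (real m * (real m - 1))"
  proof -
    have "real (card {S \<in> nsets ({1..m} - {i2}) d. i1 \<in> S}) * (real m - 1) = real d * real (m - 1 choose d)"
      using arg_cong[OF card_nsets_containing[of "{1..m} - {i2}" i1 d], of real] i m
      by (simp add: of_nat_diff)
    moreover have "(real m - real d) * real (m choose d) = real m * real (m - 1 choose d)"
      using arg_cong[OF binomial_absorb_comp[of m d], of real] d by (simp add: of_nat_diff)
    ultimately have "real (card {S \<in> nsets ({1..m} - {i2}) d. i1 \<in> S}) * (real m * (real m - 1)) =
        real d * (real m - real d) * real (m choose d)"
      by (metis (no_types, lifting) mult.assoc mult.left_commute)
    then show ?thesis
      using m d by (simp add: field_simps)
  qed
  finally show ?thesis .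
qed

text \<open>
  An entry of a column is the indicator of its support, so the law of a coefficient is an
  image of the uniform law on supports; in this form it is visibly the same for all columns.
\<close>

definition coefficient_law :: "nat \<Rightarrow> nat \<Rightarrow> ((nat \<Rightarrow> real) \<Rightarrow> real) \<Rightarrow> real measure" where
  "coefficient_law m d L =
     distr (measure_pmf (pmf_of_set (nsets {1..m} d))) borel (\<lambda>S. L (indicator S))"

lemma real_distribution_coefficient_law: "real_distribution (coefficient_law m d L)"
proof -
  have "prob_space (coefficient_law m d L)"
    unfolding coefficient_law_def by (rule measure_pmf.prob_space_distr) simp
  then show ?thesis
    by (simp add: real_distribution_def real_distribution_axioms_def coefficient_law_def)
qed

lemma nn_integral_coefficient_law:
  assumes f: "f \<in> borel_measurable borel"
  shows "(\<integral>\<^sup>+e. f e \<partial>coefficient_law m d L) = (\<integral>\<^sup>+S. f (L (indicator S)) \<partial>measure_pmf (pmf_of_set (nsets {1..m} d)))"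
  unfolding coefficient_law_def using f by (subst nn_integral_distr) simp_all

lemma nn_integral_coefficient_law_single:
  assumes i: "i \<in> {1..m}" and d: "d < m" and f: "f \<in> borel_measurable borel"
  shows "(\<integral>\<^sup>+e. f e \<partial>coefficient_law m d (\<lambda>v. v i)) =
    ennreal (1 - real d / real m) * f 0 + ennreal (real d / real m) * f 1"
proof -
  let ?p = "pmf_of_set (nsets {1..m} d)"
  have "measure_pmf.prob ?p {S. i \<notin> S} = 1 - real d / real m"
    using measure_pmf.prob_compl[of "{S. i \<in> S}" ?p] prob_nsets_containing[OF i d]
    by (simp add: Compl_eq_Diff_UNIV[symmetric] Collect_neg_eq)
  moreover have "(\<integral>\<^sup>+e. f e \<partial>coefficient_law m d (\<lambda>v. v i)) =
      (\<integral>\<^sup>+S. f 0 * indicator {S. i \<notin> S} S + f 1 * indicator {S. i \<in> S} S \<partial>measure_pmf ?p)"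
    unfolding nn_integral_coefficient_law[OF f]
    by (intro nn_integral_cong) (simp add: indicator_def)
  ultimately show ?thesis
    by (simp add: nn_integral_add nn_integral_cmult_indicator measure_pmf.emeasure_eq_measure
        prob_nsets_containing[OF i d] mult.commute del: One_nat_def)
qed

lemma nn_integral_coefficient_law_difference:
  assumes i: "i1 \<in> {1..m}" "i2 \<in> {1..m}" "i1 \<noteq> i2" and d: "d < m" and f: "f \<in> borel_measurable borel"
  defines "s \<equiv> real d * (real m - real d) / (real m * (real m - 1))"
  shows "(\<integral>\<^sup>+e. f e \<partial>coefficient_law m d (\<lambda>v. v i1 - v i2)) =
    ennreal (1 - 2 * s) * f 0 + ennreal s * f 1 + ennreal s * f (-1)"
proof -
  let ?p = "pmf_of_set (nsets {1..m} d)"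
  let ?U = "{S. i1 \<in> S \<and> i2 \<notin> S}" and ?V = "{S. i2 \<in> S \<and> i1 \<notin> S}"
  have UV: "measure_pmf.prob ?p ?U = s" "measure_pmf.prob ?p ?V = s"
    unfolding s_def using prob_nsets_separating[of i1 m i2 d] prob_nsets_separating[of i2 m i1 d] i d by auto
  have "measure_pmf.prob ?p (?U \<union> ?V) = s + s"
    using UV by (subst measure_pmf.finite_measure_Union) auto
  then have "measure_pmf.prob ?p (- (?U \<union> ?V)) = 1 - 2 * s"
    using measure_pmf.prob_compl[of "?U \<union> ?V" ?p] by (simp add: Compl_eq_Diff_UNIV)
  moreover have "(\<integral>\<^sup>+e. f e \<partial>coefficient_law m d (\<lambda>v. v i1 - v i2)) =
      (\<integral>\<^sup>+S. f 0 * indicator (- (?U \<union> ?V)) S + f 1 * indicator ?U S + f (-1) * indicator ?V S \<partial>measure_pmf ?p)"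
    unfolding nn_integral_coefficient_law[OF f]
    by (intro nn_integral_cong) (auto simp: indicator_def)
  ultimately show ?thesis
    using UV by (simp add: nn_integral_add nn_integral_cmult_indicator measure_pmf.emeasure_eq_measure
        mult.commute del: One_nat_def Compl_Un)
qed

section \<open>Linear combinations of the noisy rows\<close>

text \<open>
  The common setting of both limits. The functional \<open>L\<close> reads off entry \<open>i\<close> of a vector, or the difference
  of two entries; applied to the columns of the matrix it yields the coefficients of the signal,
  and applied to the noise vector the noise of law \<open>\<kappa>\<close>. The assumption \<open>thin\<close> says that a
  coefficient times a value of law \<open>\<mu>\<close> is zero with probability \<open>1 - r\<close> and of law \<open>\<mu>'\<close>
  otherwise; \<open>no_cancellation\<close> says that surviving values almost surely do not sum to zero.
\<close>

locale combined_rows =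
  fixes M :: "'w measure" and n m k d :: nat and \<mu> \<nu> :: "real measure"
    and A :: "'w \<Rightarrow> nat \<Rightarrow> nat \<Rightarrow> real" and x \<eta> :: "'w \<Rightarrow> nat \<Rightarrow> real"
    and L :: "(nat \<Rightarrow> real) \<Rightarrow> real" and \<mu>' \<kappa> :: "real measure" and r :: real
  assumes model: "generating_model M n m k d \<mu> \<nu> A x \<eta>"
    and \<mu>: "real_distribution \<mu>"
    and L_measurable: "L \<in> borel_measurable (vectors m)"
    and L_cong: "\<And>u v. (\<And>i. i \<in> {1..m} \<Longrightarrow> u i = v i) \<Longrightarrow> L u = L v"
    and distr_noise: "distr M borel (\<lambda>w. L (\<eta> w)) = \<kappa>"
    and r: "0 \<le> r" "r < 1"
    and \<mu>': "real_distribution \<mu>'"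
    and thin: "\<And>f. f \<in> borel_measurable borel \<Longrightarrow>
      (\<integral>\<^sup>+z. \<integral>\<^sup>+e. f (e * z) \<partial>coefficient_law m d L \<partial>\<mu>) = ennreal (1 - r) * f 0 + ennreal r * (\<integral>\<^sup>+y. f y \<partial>\<mu>')"
    and no_cancellation: "\<And>q. 1 \<le> q \<Longrightarrow> emeasure (conv_power \<mu>' q) {0} = 0"
begin

sublocale prob_space M
  using model by (simp add: generating_model_def)

abbreviation \<epsilon> :: "real measure" where
  "\<epsilon> \<equiv> coefficient_law m d L"

definition coefficient :: "nat \<Rightarrow> 'w \<Rightarrow> real" where
  "coefficient j w = L (\<lambda>i. A w i j)"

definition signal_part :: "'w \<Rightarrow> real" where
  "signal_part w = (\<Sum>j = 1..n. coefficient j w * x w j)"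

definition noise_part :: "'w \<Rightarrow> real" where
  "noise_part w = L (\<eta> w)"

abbreviation component_space :: "component \<Rightarrow> (nat \<Rightarrow> real) measure" where
  "component_space c \<equiv> (case c of Column j \<Rightarrow> vectors m | Signal \<Rightarrow> vectors n | Noise \<Rightarrow> vectors m)"

definition component_value :: "component \<Rightarrow> 'w \<Rightarrow> nat \<Rightarrow> real" where
  "component_value c w = (case c of
       Column j \<Rightarrow> restrict (\<lambda>i. A w i j) {1..m}
     | Signal \<Rightarrow> restrict (x w) {1..n}
     | Noise \<Rightarrow> restrict (\<eta> w) {1..m})"

lemma indep_components:
  "indep_vars component_space component_value (Column ` {1..n} \<union> {Signal, Noise})"
  using model unfolding generating_model_def component_value_def by blast

lemma L_restrict: "L (restrict v {1..m}) = L v"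
  by (rule L_cong) simp

lemma coefficient_eq: "coefficient j w = L (component_value (Column j) w)"
  by (simp add: coefficient_def component_value_def L_restrict del: One_nat_def)

lemma signal_eq: "j \<in> {1..n} \<Longrightarrow> x w j = component_value Signal w j"
  by (simp add: component_value_def)

lemma noise_eq: "noise_part w = L (component_value Noise w)"
  by (simp add: noise_part_def component_value_def L_restrict del: One_nat_def)

lemma measurable_component_value:
  assumes "c \<in> Column ` {1..n} \<union> {Signal, Noise}"
  shows "component_value c \<in> measurable M (component_space c)"
  using indep_components assms unfolding indep_vars_def by blast

lemma measurable_coefficient [measurable]:
  "j \<in> {1..n} \<Longrightarrow> coefficient j \<in> borel_measurable M"
  unfolding coefficient_eq[abs_def]
  using measurable_component_value[of "Column j"]
  by (intro measurable_compose[OF _ L_measurable]) simp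

lemma measurable_signal [measurable]:
  assumes "j \<in> {1..n}" shows "(\<lambda>w. x w j) \<in> borel_measurable M"
proof -
  have "component_value Signal \<in> measurable M (vectors n)"
    using measurable_component_value[of Signal] by simp
  from measurable_compose[OF this measurable_component_singleton[OF assms]]
  show ?thesis using assms by (simp add: signal_eq)
qed

lemma measurable_signal_part [measurable]: "signal_part \<in> borel_measurable M"
  unfolding signal_part_def[abs_def] by measurable

lemma measurable_noise_part [measurable]: "noise_part \<in> borel_measurable M"
  unfolding noise_eq[abs_def]
  using measurable_component_value[of Noise]
  by (intro measurable_compose[OF _ L_measurable]) simp

lemma measurable_L_component:
  assumes "c \<in> I" "component_space c = vectors m"
  shows "(\<lambda>u. L (u c)) \<in> borel_measurable (PiM I component_space)"
proof -
  have "(\<lambda>u. u c) \<in> measurable (PiM I component_space) (vectors m)"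
    using measurable_component_singleton[OF assms(1), of component_space] assms(2) by simp
  then show ?thesis by (rule measurable_compose[OF _ L_measurable])
qed

lemma measurable_signal_component:
  assumes "j \<in> {1..n}" "Signal \<in> I"
  shows "(\<lambda>u. u Signal j) \<in> borel_measurable (PiM I component_space)"
proof -
  have "(\<lambda>u. u Signal) \<in> measurable (PiM I component_space) (vectors n)"
    using measurable_component_singleton[OF assms(2), of component_space] by simp
  from measurable_compose[OF this measurable_component_singleton[OF assms(1)]]
  show ?thesis by simp
qed

lemma indep_signal_noise: "indep_var borel signal_part borel noise_part"
proof -
  let ?I = "Column ` {1..n} \<union> {Signal}"
  have "indep_var (PiM ?I component_space) (\<lambda>w. restrict (\<lambda>c. component_value c w) ?I)
      (PiM {Noise} component_space) (\<lambda>w. restrict (\<lambda>c. component_value c w) {Noise})"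
    by (rule indep_var_restrict[OF indep_components]) auto
  moreover have "(\<lambda>u. \<Sum>j = 1..n. L (u (Column j)) * u Signal j) \<in> borel_measurable (PiM ?I component_space)"
    by (intro borel_measurable_sum borel_measurable_times measurable_L_component measurable_signal_component) auto
  moreover have "(\<lambda>u. L (u Noise)) \<in> borel_measurable (PiM {Noise} component_space)"
    by (rule measurable_L_component) auto
  ultimately have "indep_var borel ((\<lambda>u. \<Sum>j = 1..n. L (u (Column j)) * u Signal j) \<circ> (\<lambda>w. restrict (\<lambda>c. component_value c w) ?I))
      borel ((\<lambda>u. L (u Noise)) \<circ> (\<lambda>w. restrict (\<lambda>c. component_value c w) {Noise}))"
    by (rule indep_var_compose)
  also have "(\<lambda>u. \<Sum>j = 1..n. L (u (Column j)) * u Signal j) \<circ> (\<lambda>w. restrict (\<lambda>c. component_value c w) ?I) = signal_part"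
    by (auto simp: fun_eq_iff signal_part_def coefficient_eq signal_eq intro!: sum.cong)
  also have "(\<lambda>u. L (u Noise)) \<circ> (\<lambda>w. restrict (\<lambda>c. component_value c w) {Noise}) = noise_part"
    by (auto simp: fun_eq_iff noise_eq)
  finally show ?thesis .
qed

lemma n_pos: "0 < n"
  using model by (simp add: generating_model_def)

lemmas real_distribution_\<epsilon> = real_distribution_coefficient_law[of m d L]

lemma distr_coefficient:
  assumes j: "j \<in> {1..n}"
  shows "distr M borel (coefficient j) = \<epsilon>"
proof -
  have "component_value (Column j) \<in> measurable M (vectors m)"
    using measurable_component_value[of "Column j"] j by simp
  from measurable_compose[OF this measurable_component_singleton]
  have "(\<lambda>w. A w i j) \<in> borel_measurable M" if "i \<in> {1..m}" for i
    using that[unfolded One_nat_def] by (simp add: component_value_def)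
  then have [measurable]: "(\<lambda>w. supp m (\<lambda>i. A w i j)) \<in> measurable M (count_space UNIV)"
    by (rule measurable_supp)
  have "coefficient j w = L (indicator (supp m (\<lambda>i. A w i j)))" if "w \<in> space M" for w
    unfolding coefficient_def
  proof (rule L_cong)
    fix i assume "i \<in> {1..m}"
    moreover from this have "A w i j \<in> {0, 1}"
      using model that j unfolding generating_model_def by blast
    ultimately show "A w i j = indicator (supp m (\<lambda>i. A w i j)) i"
      by (auto simp: supp_def)
  qed
  then have "distr M borel (coefficient j) = distr M borel (\<lambda>w. L (indicator (supp m (\<lambda>i. A w i j))))"
    by (intro distr_cong) simp_all
  also have "\<dots> = distr (distr M (count_space UNIV) (\<lambda>w. supp m (\<lambda>i. A w i j))) borel (\<lambda>S. L (indicator S))"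
    by (subst distr_distr) (simp_all add: comp_def)
  also have "distr M (count_space UNIV) (\<lambda>w. supp m (\<lambda>i. A w i j)) = measure_pmf (pmf_of_set (nsets {1..m} d))"
    using model j unfolding generating_model_def by blast
  finally show ?thesis by (simp only: coefficient_law_def)
qed

lemma real_distribution_\<kappa>: "real_distribution \<kappa>"
  using real_distribution_distr[OF measurable_noise_part] distr_noise
  by (simp add: noise_part_def[abs_def])

definition coefficients :: "'w \<Rightarrow> nat \<Rightarrow> real" where
  "coefficients w = (\<lambda>j\<in>{1..n}. coefficient j w)"

definition signal :: "'w \<Rightarrow> nat \<Rightarrow> real" where
  "signal w = restrict (x w) {1..n}"

lemma measurable_signal_vector [measurable]: "signal \<in> measurable M (vectors n)"
  unfolding signal_def[abs_def] by (rule measurable_restrict) measurable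

lemma indep_coefficients_signal:
  "indep_var (vectors n) coefficients (vectors n) signal"
proof -
  let ?I = "Column ` {1..n}"
  have "indep_var (PiM ?I component_space) (\<lambda>w. restrict (\<lambda>c. component_value c w) ?I)
      (PiM {Signal} component_space) (\<lambda>w. restrict (\<lambda>c. component_value c w) {Signal})"
    by (rule indep_var_restrict[OF indep_components]) auto
  moreover have "(\<lambda>u. \<lambda>j\<in>{1..n}. L (u (Column j))) \<in> measurable (PiM ?I component_space) (vectors n)"
    by (intro measurable_restrict measurable_L_component) auto
  moreover have "(\<lambda>u. u Signal) \<in> measurable (PiM {Signal} component_space) (vectors n)"
    using measurable_component_singleton[of Signal "{Signal}" component_space]
    by (simp del: One_nat_def)
  ultimately have "indep_var (vectors n) ((\<lambda>u. \<lambda>j\<in>{1..n}. L (u (Column j))) \<circ> (\<lambda>w. restrict (\<lambda>c. component_value c w) ?I))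
      (vectors n) ((\<lambda>u. u Signal) \<circ> (\<lambda>w. restrict (\<lambda>c. component_value c w) {Signal}))"
    by (rule indep_var_compose)
  also have "(\<lambda>u. \<lambda>j\<in>{1..n}. L (u (Column j))) \<circ> (\<lambda>w. restrict (\<lambda>c. component_value c w) ?I) = coefficients"
    by (auto simp: fun_eq_iff coefficients_def coefficient_eq restrict_def)
  also have "(\<lambda>u. u Signal) \<circ> (\<lambda>w. restrict (\<lambda>c. component_value c w) {Signal}) = signal"
    by (auto simp: fun_eq_iff signal_def component_value_def)
  finally show ?thesis .
qed

lemma distr_coefficients: "distr M (vectors n) coefficients = PiM {1..n} (\<lambda>_. \<epsilon>)"
proof -
  have "indep_vars (\<lambda>j. PiM {Column j} component_space)
      (\<lambda>j w. restrict (\<lambda>c. component_value c w) {Column j}) {1..n}"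
    by (rule indep_vars_restrict[OF indep_components]) (auto simp: disjoint_family_on_def)
  then have "indep_vars (\<lambda>_. borel) (\<lambda>j w. L (restrict (\<lambda>c. component_value c w) {Column j} (Column j))) {1..n}"
    by (rule indep_vars_compose2) (rule measurable_L_component, auto)
  then have "indep_vars (\<lambda>_. borel) coefficient {1..n}"
    by (simp add: coefficient_eq[abs_def])
  then have "distr M (vectors n) (\<lambda>w. \<lambda>j\<in>{1..n}. coefficient j w) =
      PiM {1..n} (\<lambda>j. distr M borel (coefficient j))"
    using n_pos by (subst (asm) indep_vars_iff_distr_eq_PiM') auto
  also have "\<dots> = PiM {1..n} (\<lambda>_. \<epsilon>)"
    by (intro PiM_cong) (simp_all add: distr_coefficient del: One_nat_def)
  finally show ?thesis by (simp add: coefficients_def[abs_def])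
qed

definition average :: "(real \<Rightarrow> ennreal) \<Rightarrow> nat set \<Rightarrow> (nat \<Rightarrow> real) \<Rightarrow> ennreal" where
  "average f T z = (\<integral>\<^sup>+e. f (\<Sum>j\<in>T. e j * z j) \<partial>PiM T (\<lambda>_. \<epsilon>))"

lemma measurable_average:
  assumes [measurable]: "f \<in> borel_measurable borel"
  shows "average f T \<in> borel_measurable (PiM T (\<lambda>_. borel))"
proof -
  interpret \<epsilon>: real_distribution \<epsilon> by (rule real_distribution_\<epsilon>)
  interpret P: product_prob_space "\<lambda>_. \<epsilon>" T ..
  show ?thesis unfolding average_def[abs_def] by measurable
qed

text \<open>
  On the event that the signal has support \<open>T\<close> the sum runs over \<open>T\<close> only, and the remaining coefficients
  integrate out. What is left depends only on the signal restricted to \<open>T\<close>, whose conditional law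
  is prescribed.
\<close>

lemma average_support:
  assumes [measurable]: "f \<in> borel_measurable borel"
    and "T \<subseteq> {1..n}" "\<And>j. j \<in> {1..n} - T \<Longrightarrow> z j = 0"
  shows "average f {1..n} z = average f T z"
proof -
  interpret \<epsilon>: real_distribution \<epsilon> by (rule real_distribution_\<epsilon>)
  interpret P: product_prob_space "\<lambda>_. \<epsilon>" "{1..n}" ..
  have T: "(\<Sum>j = 1..n. e j * z j) = (\<Sum>j\<in>T. restrict e T j * z j)" for e
    using assms(2,3) by (intro sum.mono_neutral_cong_right) auto
  have [measurable]: "(\<lambda>e. restrict e T) \<in> measurable (PiM {1..n} (\<lambda>_. \<epsilon>)) (PiM T (\<lambda>_. \<epsilon>))"
    by (rule measurable_restrict_subset) (use assms(2) in auto)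
  have "average f T z = (\<integral>\<^sup>+e. f (\<Sum>j\<in>T. e j * z j) \<partial>distr (PiM {1..n} (\<lambda>_. \<epsilon>)) (PiM T (\<lambda>_. \<epsilon>)) (\<lambda>e. restrict e T))"
    unfolding average_def using P.distr_restrict[of T "{1..n}"] assms(2) by simp
  also have "\<dots> = average f {1..n} z"
    unfolding average_def T by (subst nn_integral_distr) measurable
  finally show ?thesis ..
qed

lemma nn_integral_signal_part_eq_average:
  assumes [measurable]: "f \<in> borel_measurable borel"
  shows "(\<integral>\<^sup>+w. f (signal_part w) \<partial>M) = (\<integral>\<^sup>+w. average f {1..n} (x w) \<partial>M)"
proof -
  interpret \<epsilon>: real_distribution \<epsilon> by (rule real_distribution_\<epsilon>)
  interpret P: product_prob_space "\<lambda>_. \<epsilon>" "{1..n}" ..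
  have [measurable]: "coefficients \<in> measurable M (vectors n)"
    unfolding coefficients_def[abs_def] by (rule measurable_restrict) measurable
  have "prob_space (distr M (vectors n) signal)"
    by (rule prob_space_distr) measurable
  then interpret S: prob_space "distr M (vectors n) signal" .
  interpret Q: pair_prob_space "PiM {1..n} (\<lambda>_. \<epsilon>)" "distr M (vectors n) signal" ..
  let ?F = "\<lambda>(e, v). f (\<Sum>j = 1..n. e j * v j)"
  have F [measurable]: "?F \<in> borel_measurable (vectors n \<Otimes>\<^sub>M vectors n)"
    by measurable
  have "sets (PiM {1..n} (\<lambda>_. \<epsilon>) \<Otimes>\<^sub>M distr M (vectors n) signal) = sets (vectors n \<Otimes>\<^sub>M vectors n)"
    by (intro sets_pair_measure_cong sets_PiM_cong) simp_all
  from measurable_cong_sets[OF this refl] F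
  have F': "?F \<in> borel_measurable (PiM {1..n} (\<lambda>_. \<epsilon>) \<Otimes>\<^sub>M distr M (vectors n) signal)"
    by blast
  have "(\<integral>\<^sup>+w. f (signal_part w) \<partial>M) = (\<integral>\<^sup>+w. ?F (coefficients w, signal w) \<partial>M)"
    by (intro nn_integral_cong) (simp add: signal_part_def coefficients_def signal_def)
  also have "\<dots> = (\<integral>\<^sup>+u. ?F u \<partial>distr M (vectors n \<Otimes>\<^sub>M vectors n) (\<lambda>w. (coefficients w, signal w)))"
    by (subst nn_integral_distr) measurable
  also have "\<dots> = (\<integral>\<^sup>+u. ?F u \<partial>(PiM {1..n} (\<lambda>_. \<epsilon>) \<Otimes>\<^sub>M distr M (vectors n) signal))"
    using indep_coefficients_signal
    by (simp add: indep_var_distribution_eq distr_coefficients del: One_nat_def)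
  also have "\<dots> = (\<integral>\<^sup>+v. average f {1..n} v \<partial>distr M (vectors n) signal)"
    unfolding average_def using Q.nn_integral_snd[OF F'] by simp
  also have "\<dots> = (\<integral>\<^sup>+w. average f {1..n} (signal w) \<partial>M)"
    using measurable_average[OF assms, of "{1..n}"]
    by (subst nn_integral_distr) (simp_all del: One_nat_def)
  also have "\<dots> = (\<integral>\<^sup>+w. average f {1..n} (x w) \<partial>M)"
    by (intro nn_integral_cong) (simp add: average_def signal_def)
  finally show ?thesis .
qed

lemma measurable_support [measurable]:
  "(\<lambda>w. supp n (x w)) \<in> measurable M (count_space UNIV)"
  by (intro measurable_supp measurable_signal)

lemma AE_support: "AE w in M. supp n (x w) \<in> nsets {1..n} k"
proof -
  have "AE T in distr M (count_space UNIV) (\<lambda>w. supp n (x w)). T \<in> nsets {1..n} k"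
  proof -
    have "nsets {1..n} k \<noteq> {}"
      using model by (auto simp: generating_model_def nsets_eq_empty_iff)
    then have "AE T in measure_pmf (pmf_of_set (nsets {1..n} k)). T \<in> nsets {1..n} k"
      by (simp add: AE_measure_pmf_iff finite_imp_finite_nsets)
    moreover have "distr M (count_space UNIV) (\<lambda>w. supp n (x w)) = measure_pmf (pmf_of_set (nsets {1..n} k))"
      using model unfolding generating_model_def by blast
    ultimately show ?thesis by (simp only:)
  qed
  then show ?thesis by (rule AE_distrD[OF measurable_support])
qed

text \<open>
  The law of the signal is known only conditionally on its support, so integrals are split
  along the finitely many supports of cardinality \<open>k\<close>.
\<close>

lemma nn_integral_split_support:
  assumes [measurable]: "h \<in> borel_measurable M"
  shows "(\<integral>\<^sup>+w. h w \<partial>M) =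
    (\<Sum>T\<in>nsets {1..n} k. \<integral>\<^sup>+w. h w * indicator {w \<in> space M. supp n (x w) = T} w \<partial>M)"
proof -
  have fin: "finite (nsets {1..n} k)" by (rule finite_imp_finite_nsets) simp
  have "(\<integral>\<^sup>+w. h w \<partial>M) = (\<integral>\<^sup>+w. (\<Sum>T\<in>nsets {1..n} k. h w * indicator {w \<in> space M. supp n (x w) = T} w) \<partial>M)"
  proof (rule nn_integral_cong_AE)
    show "AE w in M. h w = (\<Sum>T\<in>nsets {1..n} k. h w * indicator {w \<in> space M. supp n (x w) = T} w)"
      using AE_support AE_space
    proof eventually_elim
      case (elim w)
      have "(\<Sum>T\<in>nsets {1..n} k. h w * indicator {w \<in> space M. supp n (x w) = T} w) =
          (\<Sum>T\<in>nsets {1..n} k. if T = supp n (x w) then h w else 0)"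
        using elim(2) by (intro sum.cong) (auto simp: indicator_def)
      then show ?case using elim(1) fin by simp
    qed
  qed
  also have "\<dots> = (\<Sum>T\<in>nsets {1..n} k. \<integral>\<^sup>+w. h w * indicator {w \<in> space M. supp n (x w) = T} w \<partial>M)"
    by (rule nn_integral_sum) measurable
  finally show ?thesis .
qed

text \<open>
  Averaging over the coefficients first leaves a function of the signal. Its conditional
  expectation given the support \<open>T\<close> is computed by \<open>nn_integral_thinned_sum\<close> and depends on \<open>T\<close> only
  through the cardinality \<open>k\<close>, which is the same for all supports.
\<close>

lemma nn_integral_signal_part:
  assumes [measurable]: "f \<in> borel_measurable borel"
  shows "(\<integral>\<^sup>+w. f (signal_part w) \<partial>M) =
    (\<integral>\<^sup>+q. (\<integral>\<^sup>+y. f y \<partial>conv_power \<mu>' q) \<partial>measure_pmf (binomial_pmf k r))" (is "_ = ?B")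
proof -
  have [measurable]: "(\<lambda>w. average f {1..n} (x w)) \<in> borel_measurable M"
  proof -
    have "(\<lambda>w. average f {1..n} (signal w)) \<in> borel_measurable M"
      by (rule measurable_compose[OF measurable_signal_vector measurable_average]) fact
    moreover have "average f {1..n} (signal w) = average f {1..n} (x w)" for w
      by (simp add: average_def signal_def)
    ultimately show ?thesis by simp
  qed
  have cond: "(\<integral>\<^sup>+w. average f {1..n} (x w) * indicator {w \<in> space M. supp n (x w) = T} w \<partial>M) =
      emeasure M {w \<in> space M. supp n (x w) = T} * ?B" if T: "T \<in> nsets {1..n} k" for T
  proof (cases "emeasure M {w \<in> space M. supp n (x w) = T} = 0")
    case True
    then have "AE w in M. w \<notin> {w \<in> space M. supp n (x w) = T}"
      by (intro AE_not_in) (simp add: null_sets_def)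
    then have "AE w in M. average f {1..n} (x w) * indicator {w \<in> space M. supp n (x w) = T} w = 0"
      by eventually_elim (simp only: indicator_simps mult_zero_right not_False_eq_True)
    then have "(\<integral>\<^sup>+w. average f {1..n} (x w) * indicator {w \<in> space M. supp n (x w) = T} w \<partial>M) = (\<integral>\<^sup>+w. 0 \<partial>M)"
      by (rule nn_integral_cong_AE)
    then show ?thesis using True by simp
  next
    case False
    let ?E = "{w \<in> space M. supp n (x w) = T}"
    have T': "T \<subseteq> {1..n}" "finite T" "card T = k"
      using T by (auto simp: nsets_def)
    have law: "distr (uniform_measure M ?E) (PiM T (\<lambda>_. borel)) (\<lambda>w. restrict (x w) T) = PiM T (\<lambda>_. \<mu>)"
      using model T by (simp add: generating_model_def)
    have [measurable]: "(\<lambda>w. restrict (x w) T) \<in> measurable (uniform_measure M ?E) (PiM T (\<lambda>_. borel))"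
      using T' by (intro measurable_restrict) auto
    note [measurable] = measurable_average[of f T]
    have "(\<integral>\<^sup>+w. average f {1..n} (x w) * indicator ?E w \<partial>M) =
        (\<integral>\<^sup>+w. average f T (restrict (x w) T) * indicator ?E w \<partial>M)"
    proof (intro nn_integral_cong)
      fix w
      have "average f {1..n} (x w) = average f T (restrict (x w) T)" if "supp n (x w) = T"
      proof -
        have "average f {1..n} (x w) = average f T (x w)"
          by (rule average_support) (use that in \<open>auto simp: supp_def\<close>)
        then show ?thesis by (simp add: average_def)
      qed
      then show "average f {1..n} (x w) * indicator ?E w = average f T (restrict (x w) T) * indicator ?E w"
        by (auto simp: indicator_def)
    qed
    also have "\<dots> = emeasure M ?E * (\<integral>\<^sup>+w. average f T (restrict (x w) T) \<partial>uniform_measure M ?E)"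
      using False by (subst nn_integral_uniform_measure) (simp_all add: ennreal_times_divide mult.commute[of "emeasure M _"] ennreal_mult_divide_eq)
    also have "(\<integral>\<^sup>+w. average f T (restrict (x w) T) \<partial>uniform_measure M ?E) =
        (\<integral>\<^sup>+z. average f T z \<partial>PiM T (\<lambda>_. \<mu>))"
      unfolding law[symmetric] by (subst nn_integral_distr) simp_all
    also have "\<dots> = ?B"
      unfolding average_def
      using nn_integral_thinned_sum[OF \<mu> real_distribution_\<epsilon> \<mu>' _ _ thin T'(2), of f] r T'(3) by simp
    finally show ?thesis .
  qed
  have "(\<integral>\<^sup>+w. f (signal_part w) \<partial>M) = (\<Sum>T\<in>nsets {1..n} k. emeasure M {w \<in> space M. supp n (x w) = T} * ?B)"
    unfolding nn_integral_signal_part_eq_average[OF assms]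
    by (subst nn_integral_split_support) (measurable, intro sum.cong refl cond)
  also have "\<dots> = (\<Sum>T\<in>nsets {1..n} k. emeasure M {w \<in> space M. supp n (x w) = T}) * ?B"
    by (rule sum_distrib_right[symmetric])
  also have "(\<Sum>T\<in>nsets {1..n} k. emeasure M {w \<in> space M. supp n (x w) = T}) = 1"
    using nn_integral_split_support[of "\<lambda>_. 1"] by (simp add: emeasure_space_1)
  finally show ?thesis by simp
qed

lemma emeasure_distr_signal_plus_noise:
  assumes [measurable]: "B \<in> sets borel"
  shows "emeasure (distr M borel (\<lambda>w. signal_part w + noise_part w)) B =
    (\<integral>\<^sup>+q. emeasure (convolution \<kappa> (conv_power \<mu>' q)) B \<partial>measure_pmf (binomial_pmf k r))"
proof -
  interpret \<kappa>: real_distribution \<kappa> by (rule real_distribution_\<kappa>)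
  have \<kappa>: "distr M borel noise_part = \<kappa>"
    using distr_noise by (simp add: noise_part_def[abs_def])
  have "distr M borel (\<lambda>w. signal_part w + noise_part w) = convolution (distr M borel signal_part) \<kappa>"
    using sum_indep_random_variable[OF indep_signal_noise] \<kappa> by simp
  then have "emeasure (distr M borel (\<lambda>w. signal_part w + noise_part w)) B =
      (\<integral>\<^sup>+y. indicator B y \<partial>convolution (distr M borel signal_part) \<kappa>)"
    by simp
  also have "\<dots> = (\<integral>\<^sup>+y. \<integral>\<^sup>+z. indicator B (y + z) \<partial>\<kappa> \<partial>distr M borel signal_part)"
    by (intro nn_integral_convolution_distribution real_distribution_distr real_distribution_\<kappa>) measurable
  also have "\<dots> = (\<integral>\<^sup>+w. (\<integral>\<^sup>+z. indicator B (signal_part w + z) \<partial>\<kappa>) \<partial>M)"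
    by (subst nn_integral_distr) measurable
  also have "\<dots> = (\<integral>\<^sup>+q. (\<integral>\<^sup>+y. \<integral>\<^sup>+z. indicator B (y + z) \<partial>\<kappa> \<partial>conv_power \<mu>' q) \<partial>measure_pmf (binomial_pmf k r))"
    by (rule nn_integral_signal_part) measurable
  also have "\<dots> = (\<integral>\<^sup>+q. emeasure (convolution \<kappa> (conv_power \<mu>' q)) B \<partial>measure_pmf (binomial_pmf k r))"
  proof (intro nn_integral_cong)
    fix q
    interpret C: real_distribution "conv_power \<mu>' q"
      using \<mu>' by (rule real_distribution_conv_power)
    have "(\<integral>\<^sup>+y. \<integral>\<^sup>+z. indicator B (y + z) \<partial>\<kappa> \<partial>conv_power \<mu>' q) =
        (\<integral>\<^sup>+y. indicator B y \<partial>convolution (conv_power \<mu>' q) \<kappa>)"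
      by (intro nn_integral_convolution_distribution[symmetric] C.real_distribution_axioms real_distribution_\<kappa>) measurable
    also have "convolution (conv_power \<mu>' q) \<kappa> = convolution \<kappa> (conv_power \<mu>' q)"
      by (rule convolution_commutative)
         (simp_all add: C.finite_measure_axioms \<kappa>.finite_measure_axioms)
    finally show "(\<integral>\<^sup>+y. \<integral>\<^sup>+z. indicator B (y + z) \<partial>\<kappa> \<partial>conv_power \<mu>' q) =
        emeasure (convolution \<kappa> (conv_power \<mu>' q)) B"
      by simp
  qed
  finally show ?thesis .
qed

lemma emeasure_signal_part_zero:
  "emeasure M {w \<in> space M. signal_part w = 0} = ennreal ((1 - r) ^ k)"
proof -
  have "emeasure M {w \<in> space M. signal_part w = 0} = (\<integral>\<^sup>+w. indicator {w \<in> space M. signal_part w = 0} w \<partial>M)"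
    by simp
  also have "\<dots> = (\<integral>\<^sup>+w. indicator {0} (signal_part w) \<partial>M)"
    by (intro nn_integral_cong) (simp add: indicator_def)
  also have "\<dots> = (\<integral>\<^sup>+q. (\<integral>\<^sup>+y. indicator {0} y \<partial>conv_power \<mu>' q) \<partial>measure_pmf (binomial_pmf k r))"
    by (rule nn_integral_signal_part) measurable
  also have "\<dots> = (\<integral>\<^sup>+q. indicator {0} q \<partial>measure_pmf (binomial_pmf k r))"
  proof (intro nn_integral_cong)
    fix q
    interpret C: real_distribution "conv_power \<mu>' q"
      using \<mu>' by (rule real_distribution_conv_power)
    show "(\<integral>\<^sup>+y. indicator {0} y \<partial>conv_power \<mu>' q) = indicator {0} q"
      using no_cancellation[of q] by (cases q) simp_all
  qed
  also have "\<dots> = ennreal ((1 - r) ^ k)"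
    using r by (simp add: emeasure_pmf_single)
  finally show ?thesis .
qed

text \<open>
  On the conditioning event only noise is observed, and the noise is independent of that event.
\<close>

lemma distr_conditioned_on_zero:
  "distr (uniform_measure M {w \<in> space M. signal_part w = 0}) borel
     (\<lambda>w. signal_part w + noise_part w) = \<kappa>" (is "distr (uniform_measure M ?Z) _ _ = _")
proof (rule measure_eqI)
  interpret \<kappa>: real_distribution \<kappa> by (rule real_distribution_\<kappa>)
  fix B assume "B \<in> sets (distr (uniform_measure M ?Z) borel (\<lambda>w. signal_part w + noise_part w))"
  then have [measurable]: "B \<in> sets borel" by simp
  have Z: "prob ?Z = (1 - r) ^ k"
    using emeasure_signal_part_zero r by (simp add: measure_def)
  have pos: "0 < (1 - r) ^ k" using r by simp
  have "emeasure (distr (uniform_measure M ?Z) borel (\<lambda>w. signal_part w + noise_part w)) B =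
      emeasure (uniform_measure M ?Z) ((\<lambda>w. signal_part w + noise_part w) -` B \<inter> space M)"
    by (subst emeasure_distr) simp_all
  also have "\<dots> = emeasure M (?Z \<inter> ((\<lambda>w. signal_part w + noise_part w) -` B \<inter> space M)) / emeasure M ?Z"
    by (rule emeasure_uniform_measure) measurable
  also have "?Z \<inter> ((\<lambda>w. signal_part w + noise_part w) -` B \<inter> space M) =
      (\<lambda>w. (signal_part w, noise_part w)) -` ({0} \<times> B) \<inter> space M"
    by auto
  also have "emeasure M \<dots> = ennreal (prob (signal_part -` {0} \<inter> space M) * prob (noise_part -` B \<inter> space M))"
    by (subst indep_varD[OF indep_signal_noise, symmetric]) (simp_all add: emeasure_eq_measure)
  also have "signal_part -` {0} \<inter> space M = ?Z" by auto
  also have "ennreal (prob ?Z * prob (noise_part -` B \<inter> space M)) / emeasure M ?Z =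
      ennreal (prob (noise_part -` B \<inter> space M))"
    unfolding emeasure_signal_part_zero Z using pos r
    by (simp add: divide_ennreal)
  also have "\<dots> = emeasure (distr M borel noise_part) B"
    by (simp add: emeasure_distr emeasure_eq_measure)
  also have "distr M borel noise_part = \<kappa>"
    using distr_noise by (simp add: noise_part_def[abs_def])
  finally show "emeasure (distr (uniform_measure M ?Z) borel (\<lambda>w. signal_part w + noise_part w)) B = emeasure \<kappa> B" .
qed (use real_distribution_\<kappa> in \<open>simp add: real_distribution_def real_distribution_axioms_def\<close>)

lemma bayes_signal_part_zero:
  "bayes val M {w \<in> space M. signal_part w = 0} (\<lambda>w. signal_part w + noise_part w) \<omega> =
    val \<kappa> \<omega> * ennreal ((1 - r) ^ k) / val (distr M borel (\<lambda>w. signal_part w + noise_part w)) \<omega>"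
  unfolding bayes_def distr_conditioned_on_zero emeasure_signal_part_zero ..

lemma
  assumes Y: "\<And>w. Y w = (\<Sum>j = 1..n. L (\<lambda>i. A w i j) * x w j)" and X: "\<And>w. X w = Y w + L (\<eta> w)"
  shows emeasure_noisy_combination: "B \<in> sets borel \<Longrightarrow> emeasure (distr M borel X) B =
      (\<integral>\<^sup>+q. emeasure (convolution \<kappa> (conv_power \<mu>' q)) B \<partial>measure_pmf (binomial_pmf k r))"
    and bayes_noisy_combination: "bayes val M {w \<in> space M. Y w = 0} X \<omega> =
      val \<kappa> \<omega> * ennreal ((1 - r) ^ k) / val (distr M borel X) \<omega>"
proof -
  have eqs: "Y = signal_part" "X = (\<lambda>w. signal_part w + noise_part w)"
    by (simp_all add: fun_eq_iff X Y signal_part_def coefficient_def noise_part_def)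
  show "B \<in> sets borel \<Longrightarrow> emeasure (distr M borel X) B =
      (\<integral>\<^sup>+q. emeasure (convolution \<kappa> (conv_power \<mu>' q)) B \<partial>measure_pmf (binomial_pmf k r))"
    unfolding eqs by (rule emeasure_distr_signal_plus_noise)
  show "bayes val M {w \<in> space M. Y w = 0} X \<omega> =
      val \<kappa> \<omega> * ennreal ((1 - r) ^ k) / val (distr M borel X) \<omega>"
    unfolding eqs by (rule bayes_signal_part_zero)
qed

end

section \<open>Single rows and differences of two rows\<close>

context
  fixes M :: "'w measure" and n m k d :: nat and \<mu> \<nu> :: "real measure"
    and A :: "'w \<Rightarrow> nat \<Rightarrow> nat \<Rightarrow> real" and x \<eta> :: "'w \<Rightarrow> nat \<Rightarrow> real"
  assumes model: "generating_model M n m k d \<mu> \<nu> A x \<eta>" and \<nu>: "real_distribution \<nu>"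
begin

interpretation prob_space M
  using model by (simp add: generating_model_def)

interpretation \<nu>: real_distribution \<nu> by (rule \<nu>)

lemma measurable_noise: "(\<lambda>w. restrict (\<eta> w) {1..m}) \<in> measurable M (vectors m)"
proof -
  let ?M' = "\<lambda>c. case c of Column j \<Rightarrow> vectors m | Signal \<Rightarrow> vectors n | Noise \<Rightarrow> vectors m"
  let ?X = "\<lambda>c w. case c of Column j \<Rightarrow> restrict (\<lambda>i. A w i j) {1..m}
          | Signal \<Rightarrow> restrict (x w) {1..n} | Noise \<Rightarrow> restrict (\<eta> w) {1..m}"
  have "indep_vars ?M' ?X (Column ` {1..n} \<union> {Signal, Noise})"
    using model unfolding generating_model_def by blast
  then have "?X Noise \<in> measurable M (?M' Noise)"
    unfolding indep_vars_def by blast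
  then show ?thesis by (simp del: One_nat_def)
qed

lemma measurable_noise_entry: "i \<in> {1..m} \<Longrightarrow> (\<lambda>w. \<eta> w i) \<in> borel_measurable M"
  using measurable_compose[OF measurable_noise measurable_component_singleton[of i "{1..m}"]]
  by (simp del: One_nat_def)

lemma distr_noise_vector: "distr M (vectors m) (\<lambda>w. restrict (\<eta> w) {1..m}) = PiM {1..m} (\<lambda>_. \<nu>)"
  using model unfolding generating_model_def by blast

lemma distr_noise_entry:
  assumes i: "i \<in> {1..m}"
  shows "distr M borel (\<lambda>w. \<eta> w i) = \<nu>"
proof -
  have "distr M borel (\<lambda>w. \<eta> w i) = distr (distr M (vectors m) (\<lambda>w. restrict (\<eta> w) {1..m})) borel (\<lambda>v. v i)"
    using i measurable_noise
    by (subst distr_distr) (simp_all add: comp_def measurable_component_singleton del: One_nat_def)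
  also have "\<dots> = distr (PiM {1..m} (\<lambda>_. \<nu>)) \<nu> (\<lambda>v. v i)"
    unfolding distr_noise_vector by (rule distr_cong) simp_all
  also have "\<dots> = \<nu>"
    using i \<nu>.prob_space_axioms by (intro distr_PiM_component)
  finally show ?thesis .
qed

lemma distr_noise_difference:
  assumes i: "i1 \<in> {1..m}" "i2 \<in> {1..m}" "i1 \<noteq> i2"
  shows "distr M borel (\<lambda>w. \<eta> w i1 - \<eta> w i2) = difference \<nu>"
proof -
  note [measurable] = measurable_noise_entry[OF i(1)] measurable_noise_entry[OF i(2)]
  have "distr M (vectors m) (\<lambda>w. \<lambda>i\<in>{1..m}. \<eta> w i) = PiM {1..m} (\<lambda>i. distr M borel (\<lambda>w. \<eta> w i))"
    unfolding distr_noise_vector by (intro PiM_cong refl distr_noise_entry[symmetric])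
  then have "indep_vars (\<lambda>_. borel) (\<lambda>i w. \<eta> w i) {1..m}"
    using i by (subst indep_vars_iff_distr_eq_PiM') (auto intro: measurable_noise_entry)
  then have "indep_var (PiM {i1} (\<lambda>_. borel)) (\<lambda>w. restrict (\<eta> w) {i1}) (PiM {i2} (\<lambda>_. borel)) (\<lambda>w. restrict (\<eta> w) {i2})"
    by (rule indep_var_restrict) (use i in auto)
  then have "indep_var borel ((\<lambda>v. v i1) \<circ> (\<lambda>w. restrict (\<eta> w) {i1})) borel ((\<lambda>v. - v i2) \<circ> (\<lambda>w. restrict (\<eta> w) {i2}))"
    by (rule indep_var_compose) simp_all
  then have "indep_var borel (\<lambda>w. \<eta> w i1) borel (\<lambda>w. - \<eta> w i2)"
    by (simp add: comp_def)
  then have "distr M borel (\<lambda>w. \<eta> w i1 + - \<eta> w i2) =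
      convolution (distr M borel (\<lambda>w. \<eta> w i1)) (distr M borel (\<lambda>w. - \<eta> w i2))"
    by (rule sum_indep_random_variable) measurable
  also have "distr M borel (\<lambda>w. - \<eta> w i2) = distr (distr M borel (\<lambda>w. \<eta> w i2)) borel uminus"
    by (subst distr_distr) (simp_all add: comp_def)
  finally show ?thesis
    using i by (simp add: distr_noise_entry difference_def negative_def del: One_nat_def)
qed

end

lemma combined_rows_single:
  assumes model: "generating_model M n m k d \<mu> \<nu> A x \<eta>"
    and \<mu>: "real_distribution \<mu>" and \<nu>: "real_distribution \<nu>" and i: "i \<in> {1..m}"
    and no_cancellation: "\<forall>q\<ge>1. measure (conv_power \<mu> q) {0} = 0"
  shows "combined_rows M n m k d \<mu> \<nu> A x \<eta> (\<lambda>v. v i) \<mu> \<nu> (real d / real m)"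
proof (rule combined_rows.intro)
  interpret \<mu>: real_distribution \<mu> by fact
  have d: "d < m" using model by (simp add: generating_model_def)
  show "(\<lambda>v. v i) \<in> borel_measurable (vectors m)"
    using i by (rule measurable_component_singleton)
  show "distr M borel (\<lambda>w. \<eta> w i) = \<nu>"
    by (rule distr_noise_entry[OF model \<nu> i])
  show "0 \<le> real d / real m" "real d / real m < 1"
    using d by simp_all
  show "(\<integral>\<^sup>+z. \<integral>\<^sup>+e. f (e * z) \<partial>coefficient_law m d (\<lambda>v. v i) \<partial>\<mu>) =
      ennreal (1 - real d / real m) * f 0 + ennreal (real d / real m) * (\<integral>\<^sup>+y. f y \<partial>\<mu>)"
    if [measurable]: "f \<in> borel_measurable borel" for f
    by (simp add: nn_integral_coefficient_law_single[OF i d] nn_integral_add nn_integral_cmult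
        \<mu>.emeasure_space_1[simplified])
  show "emeasure (conv_power \<mu> q) {0} = 0" if "1 \<le> q" for q
  proof -
    interpret C: real_distribution "conv_power \<mu> q"
      using \<mu> by (rule real_distribution_conv_power)
    show ?thesis using no_cancellation that by (simp add: C.emeasure_eq_measure)
  qed
qed (use model \<mu> i in auto)

text \<open>
  The two coefficients \<open>1\<close> and \<open>-1\<close> are equally likely, which is where the symmetrized law comes
  from; each has half of the rate \<open>r\<close>.
\<close>

lemma combined_rows_difference:
  assumes model: "generating_model M n m k d \<mu> \<nu> A x \<eta>"
    and \<mu>: "real_distribution \<mu>" and \<nu>: "real_distribution \<nu>"
    and i: "i1 \<in> {1..m}" "i2 \<in> {1..m}" "i1 \<noteq> i2"
    and atoms: "\<forall>a. measure \<mu> {a} = 0"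
    and r: "r = 2 * (real d * (real m - real d) / (real m * (real m - 1)))" "r < 1"
  shows "combined_rows M n m k d \<mu> \<nu> A x \<eta> (\<lambda>v. v i1 - v i2) (symmetrized \<mu>) (difference \<nu>) r"
proof (rule combined_rows.intro)
  interpret \<mu>: real_distribution \<mu> by fact
  have d: "d < m" using model by (simp add: generating_model_def)
  have m: "1 < m" using i by auto
  show "(\<lambda>v. v i1 - v i2) \<in> borel_measurable (vectors m)"
    using i by (intro borel_measurable_diff measurable_component_singleton)
  show "distr M borel (\<lambda>w. \<eta> w i1 - \<eta> w i2) = difference \<nu>"
    by (rule distr_noise_difference[OF model \<nu> i])
  define s where "s = real d * (real m - real d) / (real m * (real m - 1))"
  have s: "0 \<le> s" "r = 2 * s"
    using d m r(1) by (simp_all add: s_def)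
  show "0 \<le> r" "r < 1"
    using s r(2) by simp_all
  show "real_distribution (symmetrized \<mu>)"
    by (rule real_distribution_symmetrized[OF \<mu>])
  show "(\<integral>\<^sup>+z. \<integral>\<^sup>+e. f (e * z) \<partial>coefficient_law m d (\<lambda>v. v i1 - v i2) \<partial>\<mu>) =
      ennreal (1 - r) * f 0 + ennreal r * (\<integral>\<^sup>+y. f y \<partial>symmetrized \<mu>)"
    if [measurable]: "f \<in> borel_measurable borel" for f
  proof -
    have half: "2 * (t / 2) = t" for t :: ennreal
      by (simp add: ennreal_times_divide mult.commute[of 2] mult_divide_eq_ennreal)
    have "ennreal r * (\<integral>\<^sup>+y. f y \<partial>symmetrized \<mu>) =
        ennreal s * 2 * (((\<integral>\<^sup>+y. f y \<partial>\<mu>) + (\<integral>\<^sup>+y. f (- y) \<partial>\<mu>)) / 2)"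
      using s by (simp add: nn_integral_symmetrized ennreal_mult' mult.commute)
    also have "\<dots> = ennreal s * (\<integral>\<^sup>+y. f y \<partial>\<mu>) + ennreal s * (\<integral>\<^sup>+y. f (- y) \<partial>\<mu>)"
      by (simp only: mult.assoc half distrib_left)
    finally show ?thesis
      using s(2) by (simp add: nn_integral_coefficient_law_difference[OF i d] s_def[symmetric] nn_integral_add
          nn_integral_cmult \<mu>.emeasure_space_1[simplified] add.assoc)
  qed
  show "emeasure (conv_power (symmetrized \<mu>) q) {0} = 0" if "1 \<le> q" for q
    by (rule conv_power_symmetrized_no_atom[OF \<mu> atoms that])
qed (use model \<mu> i in auto)

section \<open>Limits of the conditional probabilities\<close>

lemma combined_rows_tendsto:
  fixes M :: "nat \<Rightarrow> 'w measure" and m k :: "nat \<Rightarrow> nat" and Y X :: "nat \<Rightarrow> 'w \<Rightarrow> real"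
  assumes rows: "\<forall>\<^sub>F n in sequentially.
      combined_rows (M n) n (m n) (k n) d \<mu> \<nu> (A n) (x n) (\<eta> n) (L n) \<mu>' \<kappa> (r n)"
    and \<kappa>: "real_distribution \<kappa>" and \<mu>': "real_distribution \<mu>'"
    and Y: "\<And>n w. Y n w = (\<Sum>j = 1..n. L n (\<lambda>i. A n w i j) * x n w j)"
    and X: "\<And>n w. X n w = Y n w + L n (\<eta> n w)"
    and p: "\<And>val n \<omega>. p val n \<omega> = bayes val (M n) {w \<in> space (M n). Y n w = 0} (X n) \<omega>"
    and \<rho>: "0 < \<rho>" and D: "0 \<le> D"
    and m: "filterlim m at_top sequentially"
    and k: "\<forall>\<^sub>F n in sequentially. \<bar>real (k n) - \<rho> * real (m n)\<bar> < 1 \<and> k n < m n"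
    and r: "\<forall>\<^sub>F n in sequentially. 0 \<le> r n \<and> r n \<le> D / real (m n)"
    and mr: "(\<lambda>n. real (m n) * r n) \<longlonglongrightarrow> D"
  shows "(absolutely_continuous lborel \<kappa> \<longrightarrow>
      (AE \<omega> in lborel. (\<lambda>n. p density_at n \<omega>) \<longlonglongrightarrow> poisson_ratio density_at (D * \<rho>) \<kappa> \<mu>' \<omega>) \<and>
      (\<forall>\<omega>. (\<forall>q. has_cont_density_at (convolution \<kappa> (conv_power \<mu>' q)) \<omega>) \<longrightarrow>
        (\<lambda>n. p density_at n \<omega>) \<longlonglongrightarrow> poisson_ratio density_at (D * \<rho>) \<kappa> \<mu>' \<omega>)) \<and>
    (\<forall>\<omega>. (\<lambda>n. p mass_at n \<omega>) \<longlonglongrightarrow> poisson_ratio mass_at (D * \<rho>) \<kappa> \<mu>' \<omega>)"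
proof -
  obtain K where K: "0 \<le> K" "filterlim k at_top sequentially"
    "\<forall>\<^sub>F n in sequentially. 0 \<le> r n \<and> r n < 1"
    "(\<lambda>n. real (k n) * (r n / (1 - r n))) \<longlonglongrightarrow> D * \<rho>"
    "\<forall>\<^sub>F n in sequentially. real (k n) * (r n / (1 - r n)) \<le> D * \<rho> * (1 + K / real (k n))"
    using sparse_rate[OF \<rho> D m k r mr] .
  show ?thesis
  proof (rule bayes_tendsto_poisson_ratio[OF \<kappa> \<mu>' _ K(1,3,2,4,5)])
    show "0 \<le> D * \<rho>" using D \<rho> by simp
    show "\<forall>\<^sub>F n in sequentially. sets (distr (M n) borel (X n)) = sets borel \<and> (\<forall>B \<in> sets borel.
        emeasure (distr (M n) borel (X n)) B =
        (\<integral>\<^sup>+q. emeasure (convolution \<kappa> (conv_power \<mu>' q)) B \<partial>measure_pmf (binomial_pmf (k n) (r n))))"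
      using rows
    proof eventually_elim
      case (elim n)
      then interpret combined_rows "M n" n "m n" "k n" d \<mu> \<nu> "A n" "x n" "\<eta> n" "L n" \<mu>' \<kappa> "r n" .
      show ?case
        using emeasure_noisy_combination[of "Y n" "X n", OF Y X] by simp
    qed
    show "\<forall>\<^sub>F n in sequentially. \<forall>val \<omega>. p val n \<omega> =
        val \<kappa> \<omega> * ennreal ((1 - r n) ^ k n) / val (distr (M n) borel (X n)) \<omega>"
      using rows unfolding p
    proof eventually_elim
      case (elim n)
      then interpret combined_rows "M n" n "m n" "k n" d \<mu> \<nu> "A n" "x n" "\<eta> n" "L n" \<mu>' \<kappa> "r n" .
      show ?case
        by (intro allI bayes_noisy_combination[of "Y n" "X n", OF Y X])
    qed
  qed
qed

theorem theoremI4: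
  fixes \<delta> \<rho> :: real and d :: nat and m k i i1 i2 :: "nat \<Rightarrow> nat"
    and \<mu> \<nu> :: "real measure" and M :: "nat \<Rightarrow> 'w measure"
    and A :: "nat \<Rightarrow> 'w \<Rightarrow> nat \<Rightarrow> nat \<Rightarrow> real" and x \<eta> :: "nat \<Rightarrow> 'w \<Rightarrow> nat \<Rightarrow> real"
  assumes "0 < \<delta>" "\<delta> < 1" "0 < \<rho>" "\<rho> < 1"
    and "real_distribution \<mu>" "real_distribution \<nu>"
    and "\<And>n. n > 1 \<Longrightarrow> \<bar>real (m n) - \<delta> * real n\<bar> < 1"
    and "\<And>n. n > 1 \<Longrightarrow> \<bar>real (k n) - \<rho> * real (m n)\<bar> < 1"
    and "\<forall>\<^sub>F n in sequentially.
           generating_model (M n) n (m n) (k n) d \<mu> \<nu> (A n) (x n) (\<eta> n)"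
    and "\<forall>\<^sub>F n in sequentially. i n \<in> {1..m n}"
    and "\<forall>\<^sub>F n in sequentially. i1 n \<in> {1..m n} \<and> i2 n \<in> {1..m n} \<and> i1 n \<noteq> i2 n"
  shows
    "((\<forall>q \<ge> 1. measure (conv_power \<mu> q) {0} = 0) \<longrightarrow>
       (absolutely_continuous lborel \<nu> \<longrightarrow>
          (AE \<omega> in lborel.
             (\<lambda>n. p_zero density_at (M n) n (A n) (x n) (\<eta> n) (i n) \<omega>)
               \<longlonglongrightarrow> poisson_ratio density_at (real d * \<rho>) \<nu> \<mu> \<omega>) \<and>
          (\<forall>\<omega>. (\<forall>q. has_cont_density_at (convolution \<nu> (conv_power \<mu> q)) \<omega>) \<longrightarrow>
             (\<lambda>n. p_zero density_at (M n) n (A n) (x n) (\<eta> n) (i n) \<omega>)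
               \<longlonglongrightarrow> poisson_ratio density_at (real d * \<rho>) \<nu> \<mu> \<omega>)) \<and>
       (\<forall>\<omega>. (\<lambda>n. p_zero mass_at (M n) n (A n) (x n) (\<eta> n) (i n) \<omega>)
               \<longlonglongrightarrow> poisson_ratio mass_at (real d * \<rho>) \<nu> \<mu> \<omega>)) \<and>
     ((\<forall>a. measure \<mu> {a} = 0) \<longrightarrow>
       (absolutely_continuous lborel (difference \<nu>) \<longrightarrow>
          (AE \<omega> in lborel.
             (\<lambda>n. p_equal density_at (M n) n (A n) (x n) (\<eta> n) (i1 n) (i2 n) \<omega>)
               \<longlonglongrightarrow> poisson_ratio density_at (2 * real d * \<rho>)
                     (difference \<nu>) (symmetrized \<mu>) \<omega>) \<and>
          (\<forall>\<omega>. (\<forall>q. has_cont_density_at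
                      (convolution (difference \<nu>) (conv_power (symmetrized \<mu>) q)) \<omega>) \<longrightarrow>
             (\<lambda>n. p_equal density_at (M n) n (A n) (x n) (\<eta> n) (i1 n) (i2 n) \<omega>)
               \<longlonglongrightarrow> poisson_ratio density_at (2 * real d * \<rho>)
                     (difference \<nu>) (symmetrized \<mu>) \<omega>)) \<and>
       (\<forall>\<omega>. (\<lambda>n. p_equal mass_at (M n) n (A n) (x n) (\<eta> n) (i1 n) (i2 n) \<omega>)
               \<longlonglongrightarrow> poisson_ratio mass_at (2 * real d * \<rho>)
                     (difference \<nu>) (symmetrized \<mu>) \<omega>))"
proof -
  note \<mu> = assms(5) and \<nu> = assms(6) and model = assms(9)
  have large: "\<forall>\<^sub>F n in sequentially. 1 < n"
    by (rule eventually_gt_at_top)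
  have m: "filterlim m at_top sequentially"
    unfolding filterlim_at_top
  proof
    fix Z :: nat
    have "filterlim (\<lambda>n. \<delta> * real n) at_top sequentially"
      by (rule filterlim_tendsto_pos_mult_at_top[OF tendsto_const assms(1) filterlim_real_sequentially])
    then have "\<forall>\<^sub>F n in sequentially. real Z + 1 < \<delta> * real n"
      unfolding filterlim_at_top_dense by blast
    with large show "\<forall>\<^sub>F n in sequentially. Z \<le> m n"
    proof eventually_elim
      case (elim n)
      then show ?case using assms(7)[of n] by linarith
    qed
  qed
  have m': "filterlim (\<lambda>n. real (m n)) at_top sequentially"
    using m by (rule filterlim_compose[OF filterlim_real_sequentially])
  have m_large: "\<forall>\<^sub>F n in sequentially. C < real (m n)" for C
    using m' unfolding filterlim_at_top_dense by blast
  have k: "\<forall>\<^sub>F n in sequentially. \<bar>real (k n) - \<rho> * real (m n)\<bar> < 1 \<and> k n < m n"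
    using model large by eventually_elim (use assms(8) in \<open>auto simp: generating_model_def\<close>)
  show ?thesis
  proof ((rule conjI; rule impI), goal_cases)
    case no_cancellation: 1
    show ?case
    proof (rule combined_rows_tendsto[where L = "\<lambda>n v. v (i n)" and r = "\<lambda>n. real d / real (m n)"])
      show "\<forall>\<^sub>F n in sequentially. combined_rows (M n) n (m n) (k n) d \<mu> \<nu> (A n) (x n) (\<eta> n)
          (\<lambda>v. v (i n)) \<mu> \<nu> (real d / real (m n))"
        using model assms(10)
        by eventually_elim (rule combined_rows_single[OF _ \<mu> \<nu> _ no_cancellation])
      show "(\<lambda>n. real (m n) * (real d / real (m n))) \<longlonglongrightarrow> real d"
      proof (rule tendsto_eventually)
        show "\<forall>\<^sub>F n in sequentially. real (m n) * (real d / real (m n)) = real d"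
          using m_large[of 0] by eventually_elim simp
      qed
      show "clean n (A n) (x n) w (i n) = (\<Sum>j = 1..n. A n w (i n) j * x n w j)" for n w
        by (rule clean_def)
      show "noisy n (A n) (x n) (\<eta> n) w (i n) = clean n (A n) (x n) w (i n) + \<eta> n w (i n)" for n w
        by (rule noisy_def)
      show "p_zero val (M n) n (A n) (x n) (\<eta> n) (i n) \<omega> =
          bayes val (M n) {w \<in> space (M n). clean n (A n) (x n) w (i n) = 0}
            (\<lambda>w. noisy n (A n) (x n) (\<eta> n) w (i n)) \<omega>" for val n \<omega>
        by (rule p_zero_def)
    qed (use \<mu> \<nu> m k assms(3) in auto)
  next
    case atoms: 2
    define r where "r n = 2 * (real d * (real (m n) - real d) / (real (m n) * (real (m n) - 1)))" for n
    have mr: "(\<lambda>n. real (m n) * r n) \<longlonglongrightarrow> 2 * real d"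
    proof -
      have "filterlim (\<lambda>n. -1 + real (m n)) at_top sequentially"
        by (rule filterlim_tendsto_add_at_top[OF tendsto_const m'])
      then have "(\<lambda>n. (real d - 1) / (-1 + real (m n))) \<longlonglongrightarrow> 0"
        by (rule real_tendsto_divide_at_top[OF tendsto_const])
      then have "(\<lambda>n. 2 * real d * (1 - (real d - 1) / (-1 + real (m n)))) \<longlonglongrightarrow> 2 * real d * (1 - 0)"
        by (intro tendsto_mult tendsto_diff tendsto_const)
      moreover have "\<forall>\<^sub>F n in sequentially. 2 * real d * (1 - (real d - 1) / (-1 + real (m n))) = real (m n) * r n"
        using m_large[of 1] by eventually_elim (simp add: r_def field_simps)
      ultimately show ?thesis
        by (auto dest: Lim_transform_eventually)
    qed
    have r: "\<forall>\<^sub>F n in sequentially. 0 \<le> r n \<and> r n \<le> 2 * real d / real (m n)"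
      using m_large[of 1] m_large[of "real d"]
    proof eventually_elim
      case (elim n)
      have "real d * (real (m n) - real d) \<le> real d * (real (m n) - 1)"
        by (cases d) (simp_all add: mult_left_mono)
      then have "real d * (real (m n) - real d) / (real (m n) * (real (m n) - 1)) \<le>
          real d * (real (m n) - 1) / (real (m n) * (real (m n) - 1))"
        using elim by (intro divide_right_mono) simp_all
      also have "\<dots> = real d / real (m n)"
        using elim by simp
      finally show ?case using elim by (simp add: r_def)
    qed
    have "\<forall>\<^sub>F n in sequentially. r n < 1"
      using r m_large[of "2 * real d"] m_large[of 0]
    proof eventually_elim
      case (elim n)
      then have "2 * real d / real (m n) < 1" by simp
      then show ?case using elim by linarith
    qed
    with model assms(11) have rows: "\<forall>\<^sub>F n in sequentially.
        combined_rows (M n) n (m n) (k n) d \<mu> \<nu> (A n) (x n) (\<eta> n)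
          (\<lambda>v. v (i1 n) - v (i2 n)) (symmetrized \<mu>) (difference \<nu>) (r n)"
      by eventually_elim
         (rule combined_rows_difference[OF _ \<mu> \<nu> _ _ _ atoms], auto simp: r_def)
    show ?case
    proof (rule combined_rows_tendsto[OF rows])
      show "clean n (A n) (x n) w (i1 n) - clean n (A n) (x n) w (i2 n) =
          (\<Sum>j = 1..n. (A n w (i1 n) j - A n w (i2 n) j) * x n w j)" for n w
        by (simp add: clean_def sum_subtractf left_diff_distrib)
      show "noisy n (A n) (x n) (\<eta> n) w (i1 n) - noisy n (A n) (x n) (\<eta> n) w (i2 n) =
          clean n (A n) (x n) w (i1 n) - clean n (A n) (x n) w (i2 n) + (\<eta> n w (i1 n) - \<eta> n w (i2 n))" for n w
        by (simp add: noisy_def)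
      show "p_equal val (M n) n (A n) (x n) (\<eta> n) (i1 n) (i2 n) \<omega> =
          bayes val (M n) {w \<in> space (M n). clean n (A n) (x n) w (i1 n) - clean n (A n) (x n) w (i2 n) = 0}
            (\<lambda>w. noisy n (A n) (x n) (\<eta> n) w (i1 n) - noisy n (A n) (x n) (\<eta> n) w (i2 n)) \<omega>" for val n \<omega>
        by (simp add: p_equal_def)
    qed (use \<mu> \<nu> m k r mr assms(3) in \<open>auto intro: real_distribution_symmetrized real_distribution_difference\<close>)
  qed
qed

end
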